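(* Let $\psi$ be a modified ruin probability for the mixed-Poisson Cramér-Lundberg model described in the context. Assume that $0<\ell_1<c/\mu$ and $G(\{\ell_1\})=0$. Suppose that there exist $\delta>0$, $B,C_1,D_1,R_1>0$, and $b>0$ such that: (1) $G$ has a density $g$ on $(\ell_1-\delta,\ell_1)$ and $g(\ell_1-z)\sim Bz^{b-1}$ as $z\downarrow0$; (2) there are constants $c_{\ell_1},R_{\ell_1}>0$ with $\psi_{\rm cl}(u,\ell_1)\sim c_{\ell_1}e^{-R_{\ell_1}u}$ as $u\to\infty$, and $\psi_{\ell_1}(u)\sim C_{\ell_1}\psi_{\rm cl}(u,\ell_1)$ as $u\to\infty$, where $C_{\ell_1}:=\int_{(-\infty,0)}\psi(y)\,\nu_{\ell_1}(\mathrm{d}y)$ and $\nu_{\ell_1}$ is the probability measure on $(-\infty,0)$ determined by $$\nu_{\ell_1}((-\infty,-x])=\frac{1}{c-\ell_1\mu}\left(ce^{-R_{\ell_1}x}-\ell_1\int_0^x e^{-R_{\ell_1}(x-z)}\bar F(z)\,\mathrm{d}z-\ell_1\int_x^{\infty}\bar F(z)\,\mathrm{d}z\right),\qquad x\ge0;$$ moreover, for every $M>0$, as $u\to\infty$, $$\sup_{0\le v\le M}\left|\frac{\psi_{\rm cl}(u,\ell_1-v/(D_1u))}{C_1e^{-R_1u}e^{-v}}-1\right|\to0,$$ $$\sup_{0\le v\le M}\left|\frac{\psi_{\ell_1-v/(D_1u)}(u)}{\psi_{\rm cl}(u,\ell_1-v/(D_1u))}-C_{\ell_1}\right|\to0;$$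 (3) the adjustment coefficient $R(\ell)$ exists for $\ell\in(\ell_1-\delta,\ell_1]$, satisfies $R(\ell_1)=R_1$, is differentiable at $\ell_1$ (from the left) with $R'(\ell_1)=-D_1$, and there is $\eta>0$ such that for every $\ell\in(0,\ell_1-\delta]$ the adjustment coefficient $R(\ell)$ exists and satisfies $R(\ell)\ge R_1+\eta$. If $\psi$ is continuous or monotone on $(-\infty,0)$, then $$\psi(u)\sim C_{\ell_1}\,\psi_{\rm cl}(u)\sim C_{\ell_1}\frac{BC_1\Gamma(b)}{(D_1u)^b}e^{-R_1u},\qquad u\to\infty.$$
   Context: Model. For initial capital $u$ and premium rate $c>0$, let $U_t=u+ct-\sum_{i=1}^{N_t}X_i$, $t\ge0$, under the probability $\mathbb{P}_u$. The claim sizes $X_1,X_2,\dots$ are i.i.d. positive random variables with distribution function $F$, tail $\bar F=1-F$ and finite mean $\mu=\mathbb{E}[X_1]$. The claim number process $(N_t)_{t\ge0}$ is a mixed Poisson process with nonnegative mixing variable $\Lambda$ having distribution function $G$ (conditionally on $\Lambda=\ell$, it is a homogeneous Poisson process of rate $\ell$), and it is independent of the claim sizes. Put $\ell_1:=\inf\{\ell\ge0:G(\ell)=1\}$; $G(\{\ell_1\})$ denotes the mass $\mathbb{P}(\Lambda=\ell_1)$. Classical ruin. The ruin time is $T:=\inf\{t>0:U_t<0\}$. For fixed intensity $\ell$, $\psi_{\rm cl}(u,\ell):=\mathbb{P}_u(T<\infty\mid\Lambda=\ell)$, with the convention $\psi_{\rm cl}(u,\ell)=1$ when $\ell\mu\ge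 c$; here and below conditioning on $\Lambda=\ell$ means that the claim number process is Poisson with rate $\ell$. The mixed-Poisson classical ruin probability is $\psi_{\rm cl}(u):=\int_{[0,\infty)}\psi_{\rm cl}(u,\ell)\,G(\mathrm{d}\ell)$. Modified ruin. A modified ruin probability is a measurable function $\psi:\mathbb{R}\to[0,1]$ such that $$\psi(u)=\int_{(-\infty,0)}\psi(y)\,\mathbb{P}_u(U_T\in \mathrm{d}y,\,T<\infty),\qquad u\ge0.$$ For fixed intensity $\ell$ and $u\ge0$, set $$\psi_\ell(u):=\int_{(-\infty,0)}\psi(y)\,\mathbb{P}_u(U_T\in \mathrm{d}y,\,T<\infty\mid\Lambda=\ell).$$ Adjustment coefficient. For $\ell\in(0,c/\mu)$, the adjustment coefficient $R(\ell)$ is the (unique, if it exists) solution $R>0$ of $\ell\left(\mathbb{E}[e^{RX_1}]-1\right)=cR$. Notation. $f(u)\sim g(u)$ means $f(u)=(1+o(1))g(u)$ in the indicated limit; $\Gamma$ is the Gamma function. *)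

theory Defs
  imports "HOL-Probability.Probability" "HOL-Library.Landau_Symbols"
begin

locale poisson_process = prob_space M
  for M :: "'w measure" +
  fixes N :: "real \<Rightarrow> 'w \<Rightarrow> nat" and rate :: real
  assumes rate_nonneg: "0 \<le> rate"
    and N_measurable: "\<And>t. 0 \<le> t \<Longrightarrow> N t \<in> M \<rightarrow>\<^sub>M count_space UNIV"
    and N_0: "\<And>w. w \<in> space M \<Longrightarrow> N 0 w = 0"
    and N_mono: "\<And>w s t. w \<in> space M \<Longrightarrow> 0 \<le> s \<Longrightarrow> s \<le> t \<Longrightarrow> N s w \<le> N t w"
    and N_right_continuous:
      "\<And>w t. w \<in> space M \<Longrightarrow> 0 \<le> t \<Longrightarrow> continuous (at_right t) (\<lambda>s. N s w)"
    and increments_indep: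
      "\<And>t :: nat \<Rightarrow> real. 0 \<le> t 0 \<Longrightarrow> mono t \<Longrightarrow>
        indep_vars (\<lambda>_. count_space UNIV) (\<lambda>k w. N (t (Suc k)) w - N (t k) w) UNIV"
    and increments_poisson:
      "\<And>s t k. 0 \<le> s \<Longrightarrow> s \<le> t \<Longrightarrow>
        prob {w \<in> space M. N t w - N s w = k} =
          (rate * (t - s)) ^ k / fact k * exp (- (rate * (t - s)))"

text \<open>The claims are \<open>X 1, X 2, \<dots>\<close>; the value of \<open>X 0\<close> is irrelevant. The last
  assumption is the independence of the \<open>\<sigma>\<close>-algebras generated by the
  claim number process and by the claim sequence.\<close>

locale cramer_lundberg = poisson_process M N rate
  for M :: "'w measure" and N rate +
  fixes X :: "nat \<Rightarrow> 'w \<Rightarrow> real" and F :: "real measure"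
  assumes X_indep: "indep_vars (\<lambda>_. borel) X {1..}"
    and X_distr: "\<And>i. 1 \<le> i \<Longrightarrow> distr M borel (X i) = F"
    and N_X_indep:
      "indep_set
        (sets (vimage_algebra (space M) (\<lambda>w. \<lambda>t\<in>{0..}. N t w) (\<Pi>\<^sub>M t\<in>{0..}. count_space UNIV)))
        (sets (vimage_algebra (space M) (\<lambda>w. \<lambda>i\<in>{1..}. X i w) (\<Pi>\<^sub>M i\<in>{1..}. borel)))"

text \<open>\<open>P\<close> is the unconditional probability measure, \<open>G\<close> the law of the mixing variable
  \<open>Lam\<close>, \<open>F\<close> the law of the claims, and \<open>K l\<close> is the conditional probability given
  \<open>Lam = l\<close>, i.e. \<open>K\<close> is a regular conditional probability. The model under \<open>K l\<close> is
  required for all \<open>l \<ge> 0\<close>, not just for \<open>G\<close>-almost all; \<open>K l\<close> is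
  irrelevant for \<open>l < 0\<close>. The initial capital \<open>u\<close> enters through \<open>surplus\<close> below,
  not through the measure.\<close>

locale mixed_poisson_cramer_lundberg = prob_space P + claim: real_distribution F
  for P :: "'w measure" and F :: "real measure" +
  fixes K :: "real \<Rightarrow> 'w measure" and Lam :: "'w \<Rightarrow> real" and G :: "real measure"
    and c :: real and N :: "real \<Rightarrow> 'w \<Rightarrow> nat" and X :: "nat \<Rightarrow> 'w \<Rightarrow> real"
  assumes premium_pos: "0 < c"
    and claim_pos: "AE x in F. 0 < x"
    and claim_integrable: "integrable F (\<lambda>x. x)"
    and Lam_measurable: "Lam \<in> borel_measurable P"
    and Lam_nonneg: "AE w in P. 0 \<le> Lam w"
    and Lam_distr: "distr P borel Lam = G"
    and kernel: "K \<in> borel \<rightarrow>\<^sub>M prob_algebra P"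
    and conditional: "\<And>A B. A \<in> sets P \<Longrightarrow> B \<in> sets borel \<Longrightarrow>
      emeasure P (A \<inter> Lam -` B) = (\<integral>\<^sup>+l\<in>B. emeasure (K l) A \<partial>G)"
    and conditional_model: "\<And>l. 0 \<le> l \<Longrightarrow> cramer_lundberg (K l) N l X F"

abbreviation claim_mean :: "real measure \<Rightarrow> real"
  where "claim_mean F \<equiv> (LINT x|F. x)"

abbreviation tail :: "real measure \<Rightarrow> real \<Rightarrow> real"
  where "tail F x \<equiv> 1 - cdf F x"

text \<open>\<open>inf {l \<ge> 0. G(l) = 1}\<close>, with value \<open>\<infinity>\<close> for an unbounded mixing law.\<close>

definition max_rate :: "real measure \<Rightarrow> ereal"
  where "max_rate G = (INF l\<in>{l. 0 \<le> l \<and> cdf G l = 1}. ereal l)"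

definition surplus ::
    "real \<Rightarrow> (real \<Rightarrow> 'w \<Rightarrow> nat) \<Rightarrow> (nat \<Rightarrow> 'w \<Rightarrow> real) \<Rightarrow> real \<Rightarrow> real \<Rightarrow> 'w \<Rightarrow> real"
  where "surplus c N X u t w = u + c * t - (\<Sum>i=1..N t w. X i w)"

definition ruin_time ::
    "real \<Rightarrow> (real \<Rightarrow> 'w \<Rightarrow> nat) \<Rightarrow> (nat \<Rightarrow> 'w \<Rightarrow> real) \<Rightarrow> real \<Rightarrow> 'w \<Rightarrow> ereal"
  where "ruin_time c N X u w = (INF t\<in>{t. 0 < t \<and> surplus c N X u t w < 0}. ereal t)"

text \<open>The sub-probability measure \<open>Q(U\<^sub>T \<in> dy, T < \<infinity>)\<close>, where \<open>Q\<close> is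
  either \<open>P\<close> or some \<open>K l\<close>.\<close>

definition ruin_law ::
    "real \<Rightarrow> (real \<Rightarrow> 'w \<Rightarrow> nat) \<Rightarrow> (nat \<Rightarrow> 'w \<Rightarrow> real) \<Rightarrow> 'w measure \<Rightarrow> real \<Rightarrow> real measure"
  where "ruin_law c N X Q u =
    distr (restrict_space Q {w \<in> space Q. ruin_time c N X u w < \<infinity>}) borel
      (\<lambda>w. surplus c N X u (real_of_ereal (ruin_time c N X u w)) w)"

definition psi_cl_at ::
    "real measure \<Rightarrow> (real \<Rightarrow> 'w measure) \<Rightarrow> real \<Rightarrow> (real \<Rightarrow> 'w \<Rightarrow> nat) \<Rightarrow> (nat \<Rightarrow> 'w \<Rightarrow> real) \<Rightarrow>
      real \<Rightarrow> real \<Rightarrow> real"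
  where "psi_cl_at F K c N X u l =
    (if c \<le> l * claim_mean F then 1
     else measure (K l) {w \<in> space (K l). ruin_time c N X u w < \<infinity>})"

definition psi_cl ::
    "real measure \<Rightarrow> (real \<Rightarrow> 'w measure) \<Rightarrow> real measure \<Rightarrow> real \<Rightarrow> (real \<Rightarrow> 'w \<Rightarrow> nat) \<Rightarrow>
      (nat \<Rightarrow> 'w \<Rightarrow> real) \<Rightarrow> real \<Rightarrow> real"
  where "psi_cl F K G c N X u = (LINT l:{0..}|G. psi_cl_at F K c N X u l)"

definition modified_ruin_probability ::
    "'w measure \<Rightarrow> real \<Rightarrow> (real \<Rightarrow> 'w \<Rightarrow> nat) \<Rightarrow> (nat \<Rightarrow> 'w \<Rightarrow> real) \<Rightarrow> (real \<Rightarrow> real) \<Rightarrow> bool"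
  where "modified_ruin_probability P c N X \<psi> \<longleftrightarrow>
    \<psi> \<in> borel_measurable borel \<and> (\<forall>y. 0 \<le> \<psi> y \<and> \<psi> y \<le> 1) \<and>
    (\<forall>u\<ge>0. \<psi> u = (LINT y:{..<0}|ruin_law c N X P u. \<psi> y))"

definition psi_at ::
    "(real \<Rightarrow> 'w measure) \<Rightarrow> real \<Rightarrow> (real \<Rightarrow> 'w \<Rightarrow> nat) \<Rightarrow> (nat \<Rightarrow> 'w \<Rightarrow> real) \<Rightarrow>
      (real \<Rightarrow> real) \<Rightarrow> real \<Rightarrow> real \<Rightarrow> real"
  where "psi_at K c N X \<psi> u l = (LINT y:{..<0}|ruin_law c N X (K l) u. \<psi> y)"

text \<open>Integrability is part of the Lundberg equation, since the Bochner integral of a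
  non-integrable function is \<open>0\<close>.\<close>

definition is_adjustment_coeff :: "real \<Rightarrow> real measure \<Rightarrow> real \<Rightarrow> real \<Rightarrow> bool"
  where "is_adjustment_coeff c F l r \<longleftrightarrow>
    0 < l \<and> l < c / claim_mean F \<and> 0 < r \<and> integrable F (\<lambda>x. exp (r * x)) \<and>
    l * ((LINT x|F. exp (r * x)) - 1) = c * r"

definition adjustment_coeff :: "real \<Rightarrow> real measure \<Rightarrow> real \<Rightarrow> real"
  where "adjustment_coeff c F l = (THE r. is_adjustment_coeff c F l r)"

definition is_limit_deficit_law ::
    "real \<Rightarrow> real measure \<Rightarrow> real \<Rightarrow> real \<Rightarrow> real measure \<Rightarrow> bool"
  where "is_limit_deficit_law c F l R \<nu> \<longleftrightarrow>
    prob_space \<nu> \<and> sets \<nu> = sets borel \<and> measure \<nu> {..<0} = 1 \<and>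
    (\<forall>x\<ge>0. measure \<nu> {..- x} =
      1 / (c - l * claim_mean F) *
        (c * exp (- R * x)
         - l * (LBINT z:{0..x}. exp (- R * (x - z)) * tail F z)
         - l * (LBINT z:{x..}. tail F z)))"

definition limit_deficit_law ::
    "real \<Rightarrow> real measure \<Rightarrow> real \<Rightarrow> real \<Rightarrow> real measure"
  where "limit_deficit_law c F l R = (THE \<nu>. is_limit_deficit_law c F l R \<nu>)"

definition has_density_on :: "real measure \<Rightarrow> (real \<Rightarrow> real) \<Rightarrow> real set \<Rightarrow> bool"
  where "has_density_on G g S \<longleftrightarrow>
    g \<in> borel_measurable (restrict_space borel S) \<and> (\<forall>l\<in>S. 0 \<le> g l) \<and>
    (\<forall>A\<in>sets borel. A \<subseteq> S \<longrightarrow> emeasure G A = (\<integral>\<^sup>+l\<in>A. ennreal (g l) \<partial>lborel))"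

end

theory Submission
  imports Defs "HOL-Real_Asymp.Real_Asymp"
begin

text \<open>Conditioning on the intensity gives \<open>\<psi>(u) = \<integral> \<psi>\<^sub>l(u) G(dl)\<close>, and
  \<open>0 \<le> \<psi>\<^sub>l(u) \<le> \<psi>\<^sub>c\<^sub>l(u, l)\<close>. Lundberg's inequality, applied with the adjustment coefficient of
  any larger intensity, bounds \<open>\<psi>\<^sub>c\<^sub>l(u, l)\<close> by
  \<open>exp (- (R1 + D1 / 2 * min \<epsilon> (l1 - l)) * u)\<close>, since the adjustment coefficient has derivative
  \<open>- D1\<close> at \<open>l1\<close>. The substitution \<open>l = l1 - v / (D1 * u)\<close> and
  dominated convergence then yield both asymptotics. Lundberg's inequality is
  obtained on a time grid, where the pair of increments and claims has a product law, and carried over to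
  continuous time by right continuity.

  If \<open>C_l1 = 0\<close>, asymptotic equivalence to \<open>0\<close> means that \<open>\<psi>\<close> must vanish for large
  \<open>u\<close>. There the hypothesis gives \<open>\<psi>\<^sub>l(u) = 0\<close> at \<open>l = l1\<close>, and the law of the deficit at ruin for
  \<open>l \<le> l1\<close> is absolutely continuous with respect to the one for \<open>l1\<close>.\<close>

section \<open>The compound Poisson process on a time grid\<close>

text \<open>The process is specified through its increments along deterministic times, so its law is
  explicit on grids only. Continuous-time quantities are reached pathwise: no claim occurs just
  after ruin, so the surplus stays negative for a while and every fine enough grid detects the ruin.
  The slope \<open>D1 / 2\<close> arises because the derivative controls only the limit of
  difference quotients; on a whole neighbourhood of \<open>l1\<close> some slope smaller than
  \<open>D1\<close> has to be accepted. After the substitution it becomes the decay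
  \<open>exp (- v / 2)\<close>, which is still integrable against \<open>v powr (b - 1)\<close>. If
  \<open>C_l1 = 0\<close>, a normalised limit 0 does not show that \<open>\<psi>\<close> vanishes.
  The comparison of intensities is made up to a finite horizon \<open>\<tau>\<close>, since over
  infinite time claim number processes of different rates have mutually singular laws. The
  comparison constant grows with \<open>\<tau>\<close>, but null sets survive the countable union
  over all horizons.\<close>

definition poisson_law :: "real \<Rightarrow> nat measure"
  where "poisson_law a = density (count_space UNIV) (\<lambda>k. ennreal (a ^ k / fact k * exp (- a)))"

lemma space_poisson_law [simp]: "space (poisson_law a) = UNIV"
  and sets_poisson_law [simp, measurable_cong]: "sets (poisson_law a) = sets (count_space UNIV)"
  by (simp_all add: poisson_law_def)

lemma nn_integral_poisson_law:
  "(\<integral>\<^sup>+k. f k \<partial>poisson_law a) = (\<Sum>k. ennreal (a ^ k / fact k * exp (- a)) * f k)"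
  by (simp add: poisson_law_def nn_integral_density nn_integral_count_space_nat)

text \<open>The probability generating function, summed as an exponential series. Later
  \<open>m\<close> is the exponential moment of one claim, so this is the exponential moment of the
  total claims in one grid cell.\<close>

lemma nn_integral_poisson_law_power:
  assumes "0 \<le> a" "0 \<le> m"
  shows "(\<integral>\<^sup>+k. ennreal m ^ k \<partial>poisson_law a) = ennreal (exp (a * (m - 1)))"
proof -
  have "(\<lambda>k. (a * m) ^ k /\<^sub>R fact k * exp (- a)) sums (exp (a * m) * exp (- a))"
    by (intro sums_mult2 exp_converges)
  then have "(\<lambda>k. a ^ k / fact k * exp (- a) * m ^ k) sums exp (a * (m - 1))"
    by (simp add: power_mult_distrib field_simps flip: exp_add)
  then have "(\<Sum>k. ennreal (a ^ k / fact k * exp (- a) * m ^ k)) = ennreal (exp (a * (m - 1)))"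
    using assms by (intro suminf_ennreal_eq) auto
  then show ?thesis
    using assms by (simp add: nn_integral_poisson_law ennreal_power flip: ennreal_mult)
qed

text \<open>The generating function at 1. The parameter 0 is included: \<open>0 ^ 0 = 1\<close>
  makes it the point mass at 0, which covers intensity 0.\<close>

lemma prob_space_poisson_law:
  assumes "0 \<le> a" shows "prob_space (poisson_law a)"
  using nn_integral_poisson_law_power[of a 1] assms by (intro prob_spaceI) simp

text \<open>For \<open>a' > 0\<close> the likelihood ratio is
  \<open>(a / a') ^ k * exp (a' - a)\<close>, and its first factor is at most 1. With the two
  parameters exchanged it would be unbounded in \<open>k\<close>.\<close>

lemma poisson_law_dominated:
  assumes "0 \<le> a" "a \<le> a'"
  shows "(\<integral>\<^sup>+k. f k \<partial>poisson_law a) \<le> ennreal (exp (a' - a)) * (\<integral>\<^sup>+k. f k \<partial>poisson_law a')"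
proof -
  have "ennreal (a ^ k / fact k * exp (- a)) * f k
      \<le> ennreal (exp (a' - a)) * (ennreal (a' ^ k / fact k * exp (- a')) * f k)" for k
  proof -
    have "a ^ k / fact k * exp (- a) \<le> a' ^ k / fact k * exp (- a)"
      using assms by (intro mult_right_mono divide_right_mono power_mono) auto
    also have "\<dots> = exp (a' - a) * (a' ^ k / fact k * exp (- a'))"
      by (simp add: exp_diff exp_minus field_simps)
    finally have "ennreal (a ^ k / fact k * exp (- a))
        \<le> ennreal (exp (a' - a)) * ennreal (a' ^ k / fact k * exp (- a'))"
      using assms by (subst ennreal_mult[symmetric]) (auto intro!: ennreal_leI)
    then show ?thesis
      by (metis mult.assoc mult_right_mono zero_le)
  qed
  then show ?thesis
    unfolding nn_integral_poisson_law by (subst ennreal_suminf_cmult[symmetric]) (intro suminf_le; auto)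
qed

section \<open>Integration over sequence spaces\<close>

context sequence_space
begin

lemma nn_integral_PiM_iter:
  assumes [measurable]: "f \<in> borel_measurable S"
  shows "(\<integral>\<^sup>+\<omega>. f \<omega> \<partial>S) = (\<integral>\<^sup>+x. \<integral>\<^sup>+\<omega>. f (case_nat x \<omega>) \<partial>S \<partial>M)"
proof -
  have "(\<integral>\<^sup>+\<omega>. f \<omega> \<partial>S) = (\<integral>\<^sup>+p. f (case_prod case_nat p) \<partial>(M \<Otimes>\<^sub>M S))"
    by (subst PiM_iter[symmetric]) (simp add: nn_integral_distr)
  also have "\<dots> = (\<integral>\<^sup>+x. \<integral>\<^sup>+\<omega>. f (case_nat x \<omega>) \<partial>S \<partial>M)"
    by (subst P.nn_integral_fst[symmetric]) auto
  finally show ?thesis .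
qed

text \<open>The first \<open>n\<close> entries and the remaining ones come from independent samples;
  this is how the claims restart after a grid cell containing \<open>n\<close> of them.\<close>

lemma nn_integral_PiM_comb_seq:
  assumes [measurable]: "f \<in> borel_measurable S"
  shows "(\<integral>\<^sup>+\<omega>. f \<omega> \<partial>S) = (\<integral>\<^sup>+\<omega>. \<integral>\<^sup>+\<omega>'. f (comb_seq n \<omega> \<omega>') \<partial>S \<partial>S)"
proof -
  have "(\<integral>\<^sup>+\<omega>. f \<omega> \<partial>S) = (\<integral>\<^sup>+p. f (case_prod (comb_seq n) p) \<partial>(S \<Otimes>\<^sub>M S))"
    by (subst PiM_comb_seq[symmetric, of n]) (simp add: nn_integral_distr)
  also have "\<dots> = (\<integral>\<^sup>+\<omega>. \<integral>\<^sup>+\<omega>'. f (comb_seq n \<omega> \<omega>') \<partial>S \<partial>S)"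
    by (subst P.nn_integral_fst[symmetric]) auto
  finally show ?thesis .
qed

lemma nn_integral_PiM_prod:
  assumes [measurable]: "f \<in> borel_measurable M"
  shows "(\<integral>\<^sup>+\<omega>. (\<Prod>i<n. f (\<omega> i)) \<partial>S) = (\<integral>\<^sup>+x. f x \<partial>M) ^ n"
proof (induction n)
  case 0
  then show ?case by (simp add: P.emeasure_space_1)
next
  case (Suc n)
  have "(\<integral>\<^sup>+\<omega>. (\<Prod>i<Suc n. f (\<omega> i)) \<partial>S) = (\<integral>\<^sup>+x. \<integral>\<^sup>+\<omega>. f x * (\<Prod>i<n. f (\<omega> i)) \<partial>S \<partial>M)"
    by (subst nn_integral_PiM_iter) (auto simp: prod.lessThan_Suc_shift simp del: prod.lessThan_Suc)
  also have "\<dots> = (\<integral>\<^sup>+x. f x * (\<integral>\<^sup>+x. f x \<partial>M) ^ n \<partial>M)"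
    by (intro nn_integral_cong) (simp add: nn_integral_cmult Suc)
  also have "\<dots> = (\<integral>\<^sup>+x. f x \<partial>M) ^ Suc n"
    by (simp add: nn_integral_multc)
  finally show ?case .
qed

end

lemma sequence_spaceI: "prob_space M \<Longrightarrow> sequence_space M"
  by (simp add: sequence_space_def product_prob_space_def product_prob_space_axioms_def
      product_sigma_finite_def prob_space_imp_sigma_finite)

text \<open>Each coordinate, peeled off from the front, costs one factor of the single-coordinate
  comparison. For \<open>a < a'\<close> the infinite product laws are mutually singular, hence the
  restriction to functionals of the first \<open>n\<close> coordinates.\<close>

lemma PiM_poisson_law_dominated:
  assumes a: "0 \<le> a" "a \<le> a'"
    and f: "f \<in> borel_measurable (\<Pi>\<^sub>M i\<in>UNIV. count_space UNIV)"
    and dep: "\<And>d d' :: nat \<Rightarrow> nat. (\<And>j. j < n \<Longrightarrow> d j = d' j) \<Longrightarrow> f d = f d'"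
  shows "(\<integral>\<^sup>+d. f d \<partial>(\<Pi>\<^sub>M i\<in>UNIV. poisson_law a))
    \<le> ennreal (exp (a' - a)) ^ n * (\<integral>\<^sup>+d. f d \<partial>(\<Pi>\<^sub>M i\<in>UNIV. poisson_law a'))"
proof -
  interpret A: sequence_space "poisson_law a"
    using a by (intro sequence_spaceI prob_space_poisson_law) auto
  interpret A': sequence_space "poisson_law a'"
    using a by (intro sequence_spaceI prob_space_poisson_law) auto
  have [measurable_cong]: "sets (\<Pi>\<^sub>M i\<in>UNIV. poisson_law a) = sets (\<Pi>\<^sub>M i\<in>UNIV. count_space UNIV)"
    "sets (\<Pi>\<^sub>M i\<in>UNIV. poisson_law a') = sets (\<Pi>\<^sub>M i\<in>UNIV. count_space UNIV)"
    by (intro sets_PiM_cong; simp)+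
  show ?thesis
    using f dep
  proof (induction n arbitrary: f)
    case 0
    have "f d = f (\<lambda>_. 0)" for d
      by (rule 0(2)) simp
    then obtain C where "f = (\<lambda>_. C)" by blast
    then show ?case
      by (simp add: A.P.emeasure_space_1 A'.P.emeasure_space_1)
  next
    case (Suc n)
    note [measurable] = Suc.prems(1)
    let ?C = "ennreal (exp (a' - a))"
    have "(\<integral>\<^sup>+d. f d \<partial>A.S) = (\<integral>\<^sup>+x. \<integral>\<^sup>+d. f (case_nat x d) \<partial>A.S \<partial>poisson_law a)"
      by (rule A.nn_integral_PiM_iter) measurable
    also have "\<dots> \<le> (\<integral>\<^sup>+x. ?C ^ n * (\<integral>\<^sup>+d. f (case_nat x d) \<partial>A'.S) \<partial>poisson_law a)"
      by (intro nn_integral_mono Suc.IH Suc.prems(2)) (auto split: nat.split)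
    also have "\<dots> = ?C ^ n * (\<integral>\<^sup>+x. (\<integral>\<^sup>+d. f (case_nat x d) \<partial>A'.S) \<partial>poisson_law a)"
      by (rule nn_integral_cmult) (simp cong: measurable_cong_sets)
    also have "\<dots> \<le> ?C ^ n * (?C * (\<integral>\<^sup>+x. (\<integral>\<^sup>+d. f (case_nat x d) \<partial>A'.S) \<partial>poisson_law a'))"
      by (rule mult_left_mono[OF poisson_law_dominated[OF a] zero_le])
    also have "\<dots> = ?C ^ n * (?C * (\<integral>\<^sup>+d. f d \<partial>A'.S))"
      by (subst A'.nn_integral_PiM_iter) measurable
    finally show ?case by (simp add: power_Suc2 mult.assoc del: power_Suc)
  qed
qed

text \<open>Here \<open>d j\<close> is the number of claims in cell \<open>j\<close>,
  \<open>y\<close> lists the claim sizes from index 0 on, and \<open>a\<close> is the premium earned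
  per cell. Counts and sizes are separate arguments because their joint law is a product.\<close>

definition grid_surplus :: "real \<Rightarrow> real \<Rightarrow> (nat \<Rightarrow> nat) \<Rightarrow> (nat \<Rightarrow> real) \<Rightarrow> nat \<Rightarrow> real"
  where "grid_surplus u a d y k = u + a * real k - (\<Sum>i<(\<Sum>j<k. d j). y i)"

lemma grid_surplus_0 [simp]: "grid_surplus u a d y 0 = u"
  by (simp add: grid_surplus_def)

text \<open>The restart property: after the first cell only the current level is remembered, since
  \<open>comb_seq\<close> has used up the first \<open>n\<close> claims and continues with the fresh
  sequence \<open>y'\<close>.\<close>

lemma grid_surplus_Suc:
  "grid_surplus u a (case_nat n d) (comb_seq n y y') (Suc k) =
    grid_surplus (u + a - (\<Sum>i<n. y i)) a d y' k"
proof -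
  have *: "(\<Sum>i<n + s. comb_seq n y y' i) = (\<Sum>i<n. y i) + (\<Sum>i<s. y' i)" for s
    by (induction s) (simp_all add: comb_seq_def)
  have "(\<Sum>j<Suc k. case_nat n d j) = n + (\<Sum>j<k. d j)"
    by (simp add: sum.lessThan_Suc_shift del: sum.lessThan_Suc)
  then show ?thesis
    unfolding grid_surplus_def by (simp only: *) (simp add: algebra_simps)
qed

lemma measurable_grid_surplus [measurable]:
  assumes [measurable]: "d \<in> M \<rightarrow>\<^sub>M (\<Pi>\<^sub>M i\<in>UNIV. count_space UNIV)" "y \<in> M \<rightarrow>\<^sub>M (\<Pi>\<^sub>M i\<in>UNIV. borel)"
  shows "(\<lambda>w. grid_surplus u a (d w) (y w) k) \<in> borel_measurable M"
proof -
  have "(\<lambda>w. \<Sum>j<k. d w j) \<in> M \<rightarrow>\<^sub>M count_space UNIV"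
    by measurable
  then have "(\<lambda>w. (\<lambda>n w. \<Sum>i<n. y w i) (\<Sum>j<k. d w j) w) \<in> borel_measurable M"
    by (rule measurable_compose_countable[rotated]) measurable
  then show ?thesis
    unfolding grid_surplus_def by measurable
qed

text \<open>The exponential supermartingale bound, as an induction on the horizon: condition on the
  first grid cell and apply the bound to the restarted process.\<close>

lemma grid_lundberg:
  assumes a: "0 \<le> a" and r: "0 \<le> r" and F: "prob_space F" "sets F = sets borel"
    and m: "0 \<le> m" "(\<integral>\<^sup>+x. ennreal (exp (r * x)) \<partial>F) = ennreal m" "a * (m - 1) \<le> r * e"
  shows "(\<integral>\<^sup>+d. \<integral>\<^sup>+y. indicator {y. \<exists>k\<le>n. grid_surplus u e d y k < 0} y
      \<partial>(\<Pi>\<^sub>M i\<in>UNIV. F) \<partial>(\<Pi>\<^sub>M i\<in>UNIV. poisson_law a)) \<le> ennreal (exp (- r * u))"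
proof (induction n arbitrary: u)
  interpret A: sequence_space "poisson_law a"
    using a by (intro sequence_spaceI prob_space_poisson_law) auto
  interpret F: sequence_space F
    using F by (intro sequence_spaceI) auto
  note F(2)[measurable_cong]
  have [measurable_cong]: "sets A.S = sets (\<Pi>\<^sub>M i\<in>UNIV. count_space UNIV)"
    "sets F.S = sets (\<Pi>\<^sub>M i\<in>UNIV. borel)"
    by (intro sets_PiM_cong; simp add: F(2))+
  define I where "I n u d y = (indicator {y. \<exists>k\<le>n. grid_surplus u e d y k < 0} y :: ennreal)" for n u d y
  have I_alt: "I n u d y = of_bool (\<exists>k\<le>n. grid_surplus u e d y k < 0)" for n u d y
    by (auto simp: I_def)
  have [measurable]: "(\<lambda>w. I n (u w) (d w) (y w)) \<in> borel_measurable M"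
    if [measurable]: "d \<in> M \<rightarrow>\<^sub>M (\<Pi>\<^sub>M i\<in>UNIV. count_space UNIV)" "y \<in> M \<rightarrow>\<^sub>M (\<Pi>\<^sub>M i\<in>UNIV. borel)"
      "u \<in> borel_measurable M" for n u d y and M :: "'z measure"
  proof -
    have "(\<lambda>w. u w + grid_surplus 0 e (d w) (y w) k) \<in> borel_measurable M" for k
      by measurable
    then have [measurable]: "(\<lambda>w. grid_surplus (u w) e (d w) (y w) k) \<in> borel_measurable M" for k
      by (simp add: grid_surplus_def algebra_simps)
    show ?thesis unfolding I_alt by measurable
  qed
  {
    case 0
    show ?case
    proof (cases "u < 0")
      case True
      then have "1 \<le> exp (- r * u)" using r by (simp add: mult_nonneg_nonpos)
      then have "1 \<le> ennreal (exp (- r * u))"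
        by (simp only: ennreal_1[symmetric] ennreal_leI)
      then show ?thesis using True
        by (simp add: A.P.emeasure_space_1 F.P.emeasure_space_1)
    qed simp
  next
    case (Suc n)
    have IH: "(\<integral>\<^sup>+d. \<integral>\<^sup>+y. I n u d y \<partial>F.S \<partial>A.S) \<le> ennreal (exp (- r * u))" for u
      using Suc by (simp add: I_def)
    have "(\<integral>\<^sup>+d. \<integral>\<^sup>+y. I (Suc n) u d y \<partial>F.S \<partial>A.S) \<le> ennreal (exp (- r * u))"
    proof (cases "u < 0")
      case True
      then have "1 \<le> exp (- r * u)" using r by (simp add: mult_nonneg_nonpos)
      then have "1 \<le> ennreal (exp (- r * u))"
        by (simp only: ennreal_1[symmetric] ennreal_leI)
      moreover have "(\<integral>\<^sup>+d. \<integral>\<^sup>+y. I (Suc n) u d y \<partial>F.S \<partial>A.S) \<le> (\<integral>\<^sup>+d. \<integral>\<^sup>+y. 1 \<partial>F.S \<partial>A.S)"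
        by (intro nn_integral_mono) (simp add: I_alt)
      ultimately show ?thesis
        unfolding nn_integral_const A.P.emeasure_space_1 F.P.emeasure_space_1 mult_1 by (rule order_trans[rotated])
    next
      case False
      let ?v = "\<lambda>k y. u + e - (\<Sum>i<k. y i)"
      have ex: "(\<exists>k\<le>Suc n. f k < 0) \<longleftrightarrow> f 0 < 0 \<or> (\<exists>k\<le>n. f (Suc k) < 0)" for f :: "nat \<Rightarrow> real"
        by (metis Suc_le_mono not0_implies_Suc zero_le)
      have step: "I (Suc n) u (case_nat k d) (comb_seq k y y') = I n (?v k y) d y'" for k d y y'
        unfolding I_alt using False by (simp add: ex grid_surplus_Suc)
      have "(\<integral>\<^sup>+d. \<integral>\<^sup>+y. I (Suc n) u d y \<partial>F.S \<partial>A.S)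
          = (\<integral>\<^sup>+k. \<integral>\<^sup>+d. \<integral>\<^sup>+y. I (Suc n) u (case_nat k d) y \<partial>F.S \<partial>A.S \<partial>poisson_law a)"
        by (rule A.nn_integral_PiM_iter) measurable
      also have "\<dots> = (\<integral>\<^sup>+k. \<integral>\<^sup>+d. \<integral>\<^sup>+y. \<integral>\<^sup>+y'. I (Suc n) u (case_nat k d) (comb_seq k y y') \<partial>F.S \<partial>F.S \<partial>A.S \<partial>poisson_law a)"
        by (rule nn_integral_cong, rule nn_integral_cong, rule F.nn_integral_PiM_comb_seq)
          (measurable, auto simp: space_PiM intro!: measurable_ident_sets sets_PiM_cong F(2))
      also have "\<dots> = (\<integral>\<^sup>+k. \<integral>\<^sup>+d. \<integral>\<^sup>+y. \<integral>\<^sup>+y'. I n (?v k y) d y' \<partial>F.S \<partial>F.S \<partial>A.S \<partial>poisson_law a)"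
        by (simp add: step)
      \<comment> \<open>The induction hypothesis integrates over \<open>d\<close> and
        \<open>y'\<close> at a fixed level, so the claims \<open>y\<close> of the first cell have to
        move outside.\<close>
      also have "\<dots> = (\<integral>\<^sup>+k. \<integral>\<^sup>+y. \<integral>\<^sup>+d. \<integral>\<^sup>+y'. I n (?v k y) d y' \<partial>F.S \<partial>A.S \<partial>F.S \<partial>poisson_law a)"
      proof (intro nn_integral_cong)
        fix k
        interpret FA: pair_sigma_finite F.S A.S ..
        show "(\<integral>\<^sup>+d. \<integral>\<^sup>+y. \<integral>\<^sup>+y'. I n (?v k y) d y' \<partial>F.S \<partial>F.S \<partial>A.S) =
            (\<integral>\<^sup>+y. \<integral>\<^sup>+d. \<integral>\<^sup>+y'. I n (?v k y) d y' \<partial>F.S \<partial>A.S \<partial>F.S)"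
          by (rule FA.Fubini') measurable
      qed
      \<comment> \<open>The level \<open>?v k y\<close> may already be negative; this is why the
        bound is proved for every real \<open>u\<close>.\<close>
      also have "\<dots> \<le> (\<integral>\<^sup>+k. \<integral>\<^sup>+y. ennreal (exp (- r * ?v k y)) \<partial>F.S \<partial>poisson_law a)"
        by (intro nn_integral_mono IH)
      also have "\<dots> = (\<integral>\<^sup>+k. \<integral>\<^sup>+y. ennreal (exp (- r * (u + e))) * (\<Prod>i<k. ennreal (exp (r * y i))) \<partial>F.S \<partial>poisson_law a)"
      proof (intro nn_integral_cong)
        fix k :: nat and y :: "nat \<Rightarrow> real"
        have "- r * ?v k y = - r * (u + e) + (\<Sum>i<k. r * y i)"
          by (simp add: algebra_simps flip: sum_distrib_left)
        then have "exp (- r * ?v k y) = exp (- r * (u + e)) * (\<Prod>i<k. exp (r * y i))"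
          by (simp only: exp_add exp_sum finite_lessThan)
        then show "ennreal (exp (- r * ?v k y)) = ennreal (exp (- r * (u + e))) * (\<Prod>i<k. ennreal (exp (r * y i)))"
          by (simp add: prod_ennreal ennreal_mult' prod_nonneg)
      qed
      also have "\<dots> = (\<integral>\<^sup>+k. ennreal (exp (- r * (u + e))) * ennreal m ^ k \<partial>poisson_law a)"
      proof (intro nn_integral_cong)
        fix k
        have "(\<integral>\<^sup>+y. (\<Prod>i<k. ennreal (exp (r * y i))) \<partial>F.S) = ennreal m ^ k"
          by (subst F.nn_integral_PiM_prod) (measurable, simp add: m(2))
        then show "(\<integral>\<^sup>+y. ennreal (exp (- r * (u + e))) * (\<Prod>i<k. ennreal (exp (r * y i))) \<partial>F.S)
            = ennreal (exp (- r * (u + e))) * ennreal m ^ k"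
          by (subst nn_integral_cmult) auto
      qed
      also have "\<dots> = ennreal (exp (- r * (u + e))) * ennreal (exp (a * (m - 1)))"
        using a m(1) by (simp add: nn_integral_cmult nn_integral_poisson_law_power)
      \<comment> \<open>Supermartingale step: by \<open>m(3)\<close> the premium factor
        \<open>exp (- r * e)\<close> compensates the claims factor \<open>exp (a * (m - 1))\<close>
        of one cell.\<close>
      also have "\<dots> \<le> ennreal (exp (- r * u))"
        using m(3) by (simp add: algebra_simps flip: ennreal_mult exp_add)
      finally show ?thesis .
    qed
    then show ?case by (simp add: I_def)
  }
qed

section \<open>Ruin along a single path\<close>

text \<open>In the discrete space of natural numbers, convergence from the right means being
  eventually equal to the limit.\<close>

lemma step_path_locally_constant:
  fixes n :: "real \<Rightarrow> nat"
  assumes "continuous (at_right t) n"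
  obtains e where "0 < e" "\<And>s. t \<le> s \<Longrightarrow> s < t + e \<Longrightarrow> n s = n t"
proof -
  have "eventually (\<lambda>s. n s = n t) (at_right t)"
    using assms by (simp add: continuous_within tendsto_discrete)
  then obtain b where "t < b" "\<And>s. t < s \<Longrightarrow> s < b \<Longrightarrow> n s = n t"
    by (auto simp: eventually_at_right_field)
  then show ?thesis
    by (intro that[of "b - t"]) (auto simp: le_less)
qed

text \<open>Index of the first negative entry; junk if there is none.\<close>

definition first_neg :: "(nat \<Rightarrow> real) \<Rightarrow> nat"
  where "first_neg s = (LEAST k. s k < 0)"

lemma measurable_first_neg [measurable]:
  assumes [measurable]: "\<And>k. (\<lambda>w. s w k) \<in> borel_measurable M"
  shows "(\<lambda>w. first_neg (s w)) \<in> M \<rightarrow>\<^sub>M count_space UNIV"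
  unfolding first_neg_def by measurable

definition grid_path :: "real \<Rightarrow> (real \<Rightarrow> 'w \<Rightarrow> nat) \<Rightarrow> (nat \<Rightarrow> 'w \<Rightarrow> real) \<Rightarrow> real \<Rightarrow> nat \<Rightarrow> 'w \<Rightarrow> nat \<Rightarrow> real"
  where "grid_path c N X u m w k = surplus c N X u (real k / real (Suc m)) w"

text \<open>Signed: the surplus at ruin itself, hence negative. Without ruin,
  \<open>real_of_ereal\<close> sends the infinite ruin time to 0 and the value carries no
  meaning.\<close>

definition deficit :: "real \<Rightarrow> (real \<Rightarrow> 'w \<Rightarrow> nat) \<Rightarrow> (nat \<Rightarrow> 'w \<Rightarrow> real) \<Rightarrow> real \<Rightarrow> 'w \<Rightarrow> real"
  where "deficit c N X u w = surplus c N X u (real_of_ereal (ruin_time c N X u w)) w"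

text \<open>A single outcome \<open>w\<close> is fixed, so all facts here are deterministic and can
  be used under \<open>P\<close> as well as under every \<open>K l\<close>.\<close>

locale risk_path =
  fixes c u :: real and N :: "real \<Rightarrow> 'w \<Rightarrow> nat" and X :: "nat \<Rightarrow> 'w \<Rightarrow> real" and w :: 'w
  assumes c_pos: "0 < c" and u_nonneg: "0 \<le> u" and N0: "N 0 w = 0"
    and right_cont: "\<And>t. 0 \<le> t \<Longrightarrow> continuous (at_right t) (\<lambda>s. N s w)"
begin

abbreviation "T \<equiv> ruin_time c N X u w"
abbreviation "U t \<equiv> surplus c N X u t w"

lemma surplus_drift:
  assumes "0 \<le> t"
  obtains e where "0 < e" "\<And>s. t \<le> s \<Longrightarrow> s < t + e \<Longrightarrow> U s = U t + c * (s - t)"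
proof -
  obtain e where e: "0 < e" "\<And>s. t \<le> s \<Longrightarrow> s < t + e \<Longrightarrow> N s w = N t w"
    by (rule step_path_locally_constant[OF right_cont[OF assms]]) (rule that)
  have "U s = U t + c * (s - t)" if "t \<le> s" "s < t + e" for s
    unfolding surplus_def e(2)[OF that] by (simp add: algebra_simps)
  with e(1) show ?thesis by (rule that)
qed

lemma U_0: "U 0 = u"
  by (simp add: surplus_def N0)

text \<open>The infimum runs over positive times; \<open>t = 0\<close> is covered because
  \<open>U 0 = u\<close> is nonnegative.\<close>

lemma ruin_time_le: "0 \<le> t \<Longrightarrow> U t < 0 \<Longrightarrow> T \<le> ereal t"
  unfolding ruin_time_def using U_0 u_nonneg by (intro INF_lower) (auto simp: less_le)

lemma ruin_time_finite_iff: "T < \<infinity> \<longleftrightarrow> (\<exists>t\<ge>0. U t < 0)"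
proof
  assume "T < \<infinity>"
  then obtain t where "0 < t" "U t < 0"
    unfolding ruin_time_def INF_less_iff by blast
  then show "\<exists>t\<ge>0. U t < 0" by (intro exI[of _ t]) simp
next
  assume "\<exists>t\<ge>0. U t < 0"
  then obtain t where "T \<le> ereal t" using ruin_time_le by blast
  also have "ereal t < \<infinity>" by simp
  finally show "T < \<infinity>" .
qed

text \<open>Just after \<open>T\<close> the path increases from \<open>U T\<close>, while negative
  values occur arbitrarily close to \<open>T\<close> from the right; so \<open>U T\<close> itself is
  negative.\<close>

lemma ruin_time_attained:
  assumes "T < \<infinity>"
  obtains t where "T = ereal t" "0 < t" "U t < 0"
proof -
  have T0: "0 \<le> T"
    unfolding ruin_time_def by (intro INF_greatest) auto
  define t where "t = real_of_ereal T"
  have t: "T = ereal t" "0 \<le> t"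
    using T0 assms by (cases T; simp add: t_def)+
  obtain e where e: "0 < e" "\<And>s. t \<le> s \<Longrightarrow> s < t + e \<Longrightarrow> U s = U t + c * (s - t)"
    using surplus_drift[OF t(2)] by blast
  have "T < ereal (t + e)"
    using e(1) t(1) by simp
  then obtain s where s: "0 < s" "U s < 0" "s < t + e"
    unfolding ruin_time_def INF_less_iff by auto
  have "t \<le> s"
    using ruin_time_le[of s] s t by auto
  then have "U t \<le> U s"
    using e(2)[of s] s c_pos by simp
  then have "U t < 0" using s by simp
  then show ?thesis
    using t U_0 u_nonneg by (intro that[of t]) (auto simp: less_le)
qed

lemma deficit_neg: "T < \<infinity> \<Longrightarrow> deficit c N X u w < 0"
  by (erule ruin_time_attained) (simp add: deficit_def)

lemma grid_path_neg_imp: "grid_path c N X u m w k < 0 \<Longrightarrow> T < \<infinity>"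
  unfolding ruin_time_finite_iff grid_path_def by (intro exI[of _ "real k / real (Suc m)"]) auto

text \<open>The surplus stays negative on an interval to the right of \<open>T\<close>. Once the
  mesh is shorter than this interval, the first negative grid point lies in it, at most one mesh
  width after \<open>T\<close>.\<close>

lemma grid_approximation:
  assumes "T < \<infinity>"
  shows "eventually (\<lambda>m. \<exists>k. grid_path c N X u m w k < 0) sequentially"
    and "(\<lambda>m. real (first_neg (grid_path c N X u m w)) / real (Suc m)) \<longlonglongrightarrow> real_of_ereal T"
    and "(\<lambda>m. grid_path c N X u m w (first_neg (grid_path c N X u m w))) \<longlonglongrightarrow> deficit c N X u w"
proof -
  obtain t where t: "T = ereal t" "0 < t" "U t < 0"
    using ruin_time_attained[OF assms] by blast
  obtain e where e: "0 < e" "\<And>s. t \<le> s \<Longrightarrow> s < t + e \<Longrightarrow> U s = U t + c * (s - t)"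
    using surplus_drift[OF less_imp_le[OF t(2)]] by blast
  \<comment> \<open>Before \<open>t + e\<close> no claim occurs; \<open>- U t / c\<close> is the
    time in which the premiums alone bring the surplus back to 0.\<close>
  let ?e = "min e (- U t / c)"
  have "?e > 0" using e(1) t(3) c_pos by (simp add: divide_neg_pos)
  let ?s = "\<lambda>m. grid_path c N X u m w" and ?h = "\<lambda>m. 1 / real (Suc m)"
  have "eventually (\<lambda>m. ?h m < ?e) sequentially"
    by (rule order_tendstoD(2)[OF LIMSEQ_Suc[OF lim_1_over_n] \<open>?e > 0\<close>])
  then have main: "eventually (\<lambda>m. (\<exists>k. ?s m k < 0) \<and> t \<le> first_neg (?s m) / real (Suc m) \<and>
      first_neg (?s m) / real (Suc m) \<le> t + ?h m \<and>
      ?s m (first_neg (?s m)) = U t + c * (first_neg (?s m) / real (Suc m) - t)) sequentially"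
  proof eventually_elim
    case (elim m)
    \<comment> \<open>The first grid index whose time is not before \<open>t\<close>.\<close>
    define k where "k = nat \<lceil>t * real (Suc m)\<rceil>"
    have k: "t * real (Suc m) \<le> real k" "real k < t * real (Suc m) + 1"
      using t(2) ceiling_correct[of "t * real (Suc m)"] unfolding k_def by (auto simp: of_nat_nat)
    have k': "t \<le> real k / real (Suc m)" "real k / real (Suc m) < t + ?h m"
    proof -
      show "t \<le> real k / real (Suc m)"
        using k(1) by (subst pos_le_divide_eq) auto
      have "real k / real (Suc m) < (t * real (Suc m) + 1) / real (Suc m)"
        using k(2) by (intro divide_strict_right_mono) auto
      also have "\<dots> = t + ?h m"
        by (simp add: add_divide_distrib del: of_nat_Suc)
      finally show "real k / real (Suc m) < t + ?h m" .
    qed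
    have "?s m k = U t + c * (real k / real (Suc m) - t)"
      unfolding grid_path_def using k' elim by (intro e(2)) auto
    also have "\<dots> < 0"
    proof -
      have "real k / real (Suc m) - t < - U t / c" using k' elim by linarith
      then show ?thesis using c_pos by (simp add: field_simps)
    qed
    finally have neg: "?s m k < 0" .
    define j where "j = first_neg (?s m)"
    have j: "?s m j < 0" "j \<le> k"
      unfolding j_def first_neg_def using neg by (auto intro: LeastI Least_le)
    \<comment> \<open>Minimality gives only \<open>j \<le> k\<close>; the lower bound holds because
      no time before \<open>T\<close> has negative surplus.\<close>
    have "T \<le> ereal (real j / real (Suc m))"
      using j(1) by (intro ruin_time_le) (auto simp: grid_path_def)
    then have j1: "t \<le> real j / real (Suc m)" using t by simp
    have j2: "real j / real (Suc m) \<le> t + ?h m"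
      using j(2) k'(2) by (smt (verit) divide_right_mono of_nat_0_le_iff of_nat_mono)
    have "?s m j = U t + c * (real j / real (Suc m) - t)"
      unfolding grid_path_def using j1 j2 elim by (intro e(2)) auto
    with neg j1 j2 show ?case
      unfolding j_def[symmetric] by blast
  qed
  then show "eventually (\<lambda>m. \<exists>k. ?s m k < 0) sequentially"
    by eventually_elim blast
  have lim: "(\<lambda>m. real (first_neg (?s m)) / real (Suc m)) \<longlonglongrightarrow> t"
  proof (rule tendsto_sandwich[of "\<lambda>_. t" _ _ "\<lambda>m. t + ?h m"])
    show "(\<lambda>m. t + ?h m) \<longlonglongrightarrow> t"
      using tendsto_add[OF tendsto_const LIMSEQ_Suc[OF lim_1_over_n], of t] by simp
  qed (use main in \<open>auto elim: eventually_mono\<close>)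
  then show "(\<lambda>m. real (first_neg (?s m)) / real (Suc m)) \<longlonglongrightarrow> real_of_ereal T"
    using t by simp
  have "(\<lambda>m. U t + c * (real (first_neg (?s m)) / real (Suc m) - t)) \<longlonglongrightarrow> U t + c * (t - t)"
    by (intro tendsto_intros lim)
  then have "(\<lambda>m. U t + c * (real (first_neg (?s m)) / real (Suc m) - t)) \<longlonglongrightarrow> deficit c N X u w"
    using t by (simp add: deficit_def)
  moreover have "eventually (\<lambda>m. U t + c * (real (first_neg (?s m)) / real (Suc m) - t) = ?s m (first_neg (?s m))) sequentially"
    using main by eventually_elim simp
  ultimately show "(\<lambda>m. ?s m (first_neg (?s m))) \<longlonglongrightarrow> deficit c N X u w"
    by (rule Lim_transform_eventually)
qed

end

text \<open>Continuous in time, so that the grid functionals below converge even if ruin occurs exactly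
  at the horizon \<open>\<tau>\<close>.\<close>

definition cutoff :: "nat \<Rightarrow> real \<Rightarrow> real"
  where "cutoff \<tau> t = max 0 (min 1 (real \<tau> - t))"

lemma cutoff_bounds: "0 \<le> cutoff \<tau> t" "cutoff \<tau> t \<le> 1"
  by (auto simp: cutoff_def)

lemma measurable_cutoff [measurable]: "cutoff \<tau> \<in> borel_measurable borel"
  unfolding cutoff_def by measurable

text \<open>Grid version of \<open>\<phi> (deficit) * cutoff \<tau> (ruin time)\<close>. The test
  looks only at grid points up to time \<open>\<tau>\<close>, so finitely many increments determine
  the value.\<close>

definition grid_functional :: "nat \<Rightarrow> (real \<Rightarrow> real) \<Rightarrow> nat \<Rightarrow> (nat \<Rightarrow> real) \<Rightarrow> real"
  where "grid_functional \<tau> \<phi> m s =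
    (if \<exists>k\<le>\<tau> * Suc m. s k < 0 then \<phi> (s (first_neg s)) * cutoff \<tau> (real (first_neg s) / real (Suc m)) else 0)"

lemma measurable_grid_functional [measurable]:
  assumes [measurable]: "\<phi> \<in> borel_measurable borel" "\<And>k. (\<lambda>w. s w k) \<in> borel_measurable M"
  shows "(\<lambda>w. grid_functional \<tau> \<phi> m (s w)) \<in> borel_measurable M"
proof -
  have [measurable]: "(\<lambda>w. s w (first_neg (s w))) \<in> borel_measurable M"
    by (rule measurable_compose_countable[of "\<lambda>k w. s w k"]) measurable
  show ?thesis unfolding grid_functional_def by measurable
qed

text \<open>If a negative entry exists up to the horizon, then so does the first one, and entries
  beyond the horizon cannot change it.\<close>

lemma grid_functional_cong:
  assumes "\<And>k. k \<le> \<tau> * Suc m \<Longrightarrow> s k = s' k"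
  shows "grid_functional \<tau> \<phi> m s = grid_functional \<tau> \<phi> m s'"
proof (cases "\<exists>k\<le>\<tau> * Suc m. s k < 0")
  case True
  then obtain k where k: "k \<le> \<tau> * Suc m" "s k < 0" by blast
  have "first_neg s \<le> k" "first_neg s' \<le> k"
    unfolding first_neg_def using k assms by (auto intro!: Least_le)
  moreover have "first_neg s = first_neg s'"
  proof (rule antisym)
    have "s (first_neg s) < 0" "s' (first_neg s') < 0"
      unfolding first_neg_def using k(2) assms[OF k(1)]
      by (auto intro: LeastI[of "\<lambda>k. s k < 0" k] LeastI[of "\<lambda>k. s' k < 0" k])
    moreover have "first_neg s \<le> \<tau> * Suc m" "first_neg s' \<le> \<tau> * Suc m"
      using k \<open>first_neg s \<le> k\<close> \<open>first_neg s' \<le> k\<close> by linarith+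
    ultimately have "s' (first_neg s) < 0" "s (first_neg s') < 0"
      using assms by auto
    then show "first_neg s \<le> first_neg s'" "first_neg s' \<le> first_neg s"
      by (auto simp: first_neg_def intro: Least_le)
  qed
  ultimately show ?thesis
    using assms k unfolding grid_functional_def by (auto simp del: mult_Suc_right)
qed (use assms in \<open>auto simp: grid_functional_def\<close>)

lemma (in risk_path) grid_functional_tendsto:
  assumes "continuous_on UNIV \<phi>"
  shows "(\<lambda>m. grid_functional \<tau> \<phi> m (grid_path c N X u m w)) \<longlonglongrightarrow>
    (if T < \<infinity> then \<phi> (deficit c N X u w) * cutoff \<tau> (real_of_ereal T) else 0)"
proof (cases "T < \<infinity>")
  case True
  note lim = grid_approximation[OF True]
  let ?s = "\<lambda>m. grid_path c N X u m w"
  have "(\<lambda>m. \<phi> (?s m (first_neg (?s m))) * cutoff \<tau> (real (first_neg (?s m)) / real (Suc m)))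
      \<longlonglongrightarrow> \<phi> (deficit c N X u w) * cutoff \<tau> (real_of_ereal T)"
    using assms lim(2,3) unfolding cutoff_def
    by (intro tendsto_intros continuous_on_tendsto_compose[OF assms lim(3)]) auto
  moreover have "eventually (\<lambda>m. \<phi> (?s m (first_neg (?s m))) * cutoff \<tau> (real (first_neg (?s m)) / real (Suc m))
      = grid_functional \<tau> \<phi> m (?s m)) sequentially"
    using lim(1)
  proof eventually_elim
    case (elim m)
    show ?case
    proof (cases "\<exists>k\<le>\<tau> * Suc m. ?s m k < 0")
      \<comment> \<open>The first negative grid time is then at least \<open>\<tau>\<close>, where
        the cutoff is 0; both expressions vanish.\<close>
      case False
      have "?s m (first_neg (?s m)) < 0"
        unfolding first_neg_def using elim by (metis LeastI)
      then have "\<tau> * Suc m \<le> first_neg (?s m)"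
        using False by (metis linorder_le_cases)
      then have "real (\<tau> * Suc m) \<le> real (first_neg (?s m))"
        by (rule of_nat_mono)
      then have "real \<tau> \<le> real (first_neg (?s m)) / real (Suc m)"
        by (subst pos_le_divide_eq) (simp_all only: of_nat_mult of_nat_0_less_iff zero_less_Suc)
      then show ?thesis using False by (simp add: grid_functional_def cutoff_def)
    qed (simp add: grid_functional_def)
  qed
  ultimately show ?thesis
    using True by (simp add: Lim_transform_eventually)
next
  case False
  then have "\<not> grid_path c N X u m w k < 0" for m k
    using grid_path_neg_imp by blast
  then have "grid_functional \<tau> \<phi> m (grid_path c N X u m w) = 0" for m
    by (auto simp: grid_functional_def)
  then show ?thesis using False by simp
qed

section \<open>Lundberg's inequality\<close>

text \<open>Formulated with the two independent set systems themselves, since the model states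
  independence for the \<sigma>-algebras of the whole process and of the whole claim
  sequence.\<close>

lemma (in prob_space) distr_Pair_indep_set:
  assumes X: "X \<in> M \<rightarrow>\<^sub>M S" and Y: "Y \<in> M \<rightarrow>\<^sub>M L" and indep: "indep_set A B"
    and A: "\<And>C. C \<in> sets S \<Longrightarrow> X -` C \<inter> space M \<in> A"
    and B: "\<And>C. C \<in> sets L \<Longrightarrow> Y -` C \<inter> space M \<in> B"
  shows "distr M (S \<Otimes>\<^sub>M L) (\<lambda>w. (X w, Y w)) = distr M S X \<Otimes>\<^sub>M distr M L Y"
proof (rule pair_measure_eqI[symmetric])
  show "sigma_finite_measure (distr M S X)" "sigma_finite_measure (distr M L Y)"
    using prob_space_distr[OF X] prob_space_distr[OF Y] by (auto intro: prob_space_imp_sigma_finite)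
  fix C D assume "C \<in> sets (distr M S X)" "D \<in> sets (distr M L Y)"
  then have CD: "C \<in> sets S" "D \<in> sets L" by simp_all
  have "emeasure (distr M (S \<Otimes>\<^sub>M L) (\<lambda>w. (X w, Y w))) (C \<times> D)
      = emeasure M ((X -` C \<inter> space M) \<inter> (Y -` D \<inter> space M))"
    using X Y CD by (subst emeasure_distr) (auto intro!: arg_cong[where f="emeasure M"])
  also have "\<dots> = emeasure M (X -` C \<inter> space M) * emeasure M (Y -` D \<inter> space M)"
    using indep A[OF CD(1)] B[OF CD(2)] unfolding indep_sets2_eq
    by (simp add: emeasure_eq_measure ennreal_mult)
  finally show "emeasure (distr M S X) C * emeasure (distr M L Y) D
      = emeasure (distr M (S \<Otimes>\<^sub>M L) (\<lambda>w. (X w, Y w))) (C \<times> D)"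
    using X Y CD by (simp add: emeasure_distr)
qed simp

context cramer_lundberg
begin

lemma sets_F [measurable_cong]: "sets F = sets borel"
  using X_distr[of 1] by auto

lemma X_measurable: "1 \<le> i \<Longrightarrow> X i \<in> borel_measurable M"
  using X_indep by (auto simp: indep_vars_def2)

lemma prob_space_F: "prob_space F"
  using X_distr[of 1] prob_space_distr[OF X_measurable[of 1]] by simp

lemma surplus_measurable: "0 \<le> t \<Longrightarrow> surplus c N X u t \<in> borel_measurable M"
proof -
  assume "0 \<le> t"
  have "(\<lambda>w. (\<lambda>n w. \<Sum>i=1..n. X i w) (N t w) w) \<in> borel_measurable M"
    by (rule measurable_compose_countable[rotated, OF N_measurable[OF \<open>0 \<le> t\<close>]])
      (auto intro!: borel_measurable_sum X_measurable)
  then show ?thesis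
    unfolding surplus_def[abs_def] by measurable
qed

lemma risk_pathI: "0 < c \<Longrightarrow> 0 \<le> u \<Longrightarrow> w \<in> space M \<Longrightarrow> risk_path c u N w"
  using N_0 N_right_continuous by unfold_locales auto

lemma grid_path_measurable [measurable]: "(\<lambda>w. grid_path c N X u m w k) \<in> borel_measurable M"
  unfolding grid_path_def by (rule surplus_measurable) simp

text \<open>Ruin is a union over uncountably many times; the grids of all mesh widths turn it into a
  countable union, hence a measurable event.\<close>

lemma ruin_iff_grid:
  assumes "0 < c" "0 \<le> u" "w \<in> space M"
  shows "ruin_time c N X u w < \<infinity> \<longleftrightarrow> (\<exists>m k. grid_path c N X u m w k < 0)"
proof -
  interpret risk_path c u N X w using assms by (rule risk_pathI)
  show ?thesis
    using grid_path_neg_imp grid_approximation(1) by (auto simp: eventually_sequentially)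
qed

lemma ruin_event_pred:
  assumes "0 < c" "0 \<le> u"
  shows "Measurable.pred M (\<lambda>w. ruin_time c N X u w < \<infinity>)"
proof -
  have "Measurable.pred M (\<lambda>w. \<exists>m k. grid_path c N X u m w k < 0)"
    by measurable
  then show ?thesis
    by (subst measurable_cong[OF ruin_iff_grid[OF assms]])
qed

lemma first_neg_value_measurable:
  "(\<lambda>w. grid_path c N X u m w (first_neg (grid_path c N X u m w))) \<in> borel_measurable M"
  by (rule measurable_compose_countable[of "\<lambda>k w. grid_path c N X u m w k"]) measurable

text \<open>A pointwise limit of grid values on the ruin event. Elsewhere the value is set to 0,
  because \<open>first_neg\<close> is junk on paths without ruin.\<close>

lemma deficit_measurable:
  assumes "0 < c" "0 \<le> u"
  shows "(\<lambda>w. if ruin_time c N X u w < \<infinity> then deficit c N X u w else 0) \<in> borel_measurable M"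
proof (rule borel_measurable_LIMSEQ_real)
  note [measurable] = ruin_event_pred[OF assms] first_neg_value_measurable
  show "(\<lambda>w. if ruin_time c N X u w < \<infinity> then grid_path c N X u m w (first_neg (grid_path c N X u m w)) else 0)
      \<in> borel_measurable M" for m
    by measurable
  fix w assume "w \<in> space M"
  then interpret risk_path c u N X w using assms by (intro risk_pathI)
  show "(\<lambda>m. if ruin_time c N X u w < \<infinity> then grid_path c N X u m w (first_neg (grid_path c N X u m w)) else 0)
      \<longlonglongrightarrow> (if ruin_time c N X u w < \<infinity> then deficit c N X u w else 0)"
    using grid_approximation(3) by simp
qed

lemma ruin_time_measurable:
  assumes "0 < c" "0 \<le> u"
  shows "(\<lambda>w. if ruin_time c N X u w < \<infinity> then real_of_ereal (ruin_time c N X u w) else 0) \<in> borel_measurable M"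
proof (rule borel_measurable_LIMSEQ_real)
  note [measurable] = ruin_event_pred[OF assms]
  show "(\<lambda>w. if ruin_time c N X u w < \<infinity> then real (first_neg (grid_path c N X u m w)) / real (Suc m) else 0)
      \<in> borel_measurable M" for m
    by measurable
  fix w assume "w \<in> space M"
  then interpret risk_path c u N X w using assms by (intro risk_pathI)
  show "(\<lambda>m. if ruin_time c N X u w < \<infinity> then real (first_neg (grid_path c N X u m w)) / real (Suc m) else 0)
      \<longlonglongrightarrow> (if ruin_time c N X u w < \<infinity> then real_of_ereal (ruin_time c N X u w) else 0)"
    using grid_approximation(2) by simp
qed

section \<open>Product law of the grid increments and the claims\<close>

definition increments :: "real \<Rightarrow> 'w \<Rightarrow> nat \<Rightarrow> nat"
  where "increments h w k = N (real (Suc k) * h) w - N (real k * h) w"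

text \<open>Shifts the index, since the claims of the model begin with \<open>X 1\<close> and
  sequence spaces with index 0.\<close>

definition claims :: "'w \<Rightarrow> nat \<Rightarrow> real"
  where "claims w i = X (Suc i) w"

lemma sum_increments:
  assumes "0 < h" "w \<in> space M"
  shows "(\<Sum>j<k. increments h w j) = N (real k * h) w"
proof (induction k)
  case (Suc k)
  \<comment> \<open>Subtraction of natural numbers is truncated, so telescoping relies on monotone
    paths.\<close>
  have "N (real k * h) w \<le> N (real (Suc k) * h) w"
    using assms by (intro N_mono) auto
  then show ?case
    using Suc by (simp add: increments_def del: of_nat_Suc)
qed (simp add: N_0 assms)

lemma grid_path_eq_grid_surplus:
  assumes "w \<in> space M"
  shows "grid_path c N X u m w k =
    grid_surplus u (c / real (Suc m)) (increments (1 / real (Suc m)) w) (claims w) k"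
proof -
  have "(\<Sum>i=1..n. X i w) = (\<Sum>i<n. claims w i)" for n
    unfolding claims_def by (induction n) auto
  then show ?thesis
    using sum_increments[of "1 / real (Suc m)" w k] assms
    by (simp add: grid_path_def surplus_def grid_surplus_def del: of_nat_Suc)
qed

lemma increments_measurable:
  assumes "0 < h" shows "increments h \<in> M \<rightarrow>\<^sub>M (\<Pi>\<^sub>M k\<in>UNIV. count_space UNIV)"
proof (rule measurable_PiM_single')
  show "(\<lambda>w. increments h w k) \<in> M \<rightarrow>\<^sub>M count_space UNIV" for k
  proof -
    have [measurable]: "N (real j * h) \<in> M \<rightarrow>\<^sub>M count_space UNIV" for j
      using assms by (intro N_measurable) auto
    show ?thesis unfolding increments_def by measurable
  qed
qed auto

lemma claims_measurable: "claims \<in> M \<rightarrow>\<^sub>M (\<Pi>\<^sub>M k\<in>UNIV. borel)"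
  by (rule measurable_PiM_single') (auto simp: claims_def intro: X_measurable)

lemma distr_increment:
  assumes "0 < h"
  shows "distr M (count_space UNIV) (\<lambda>w. increments h w k) = poisson_law (rate * h)"
proof (rule measure_eqI_countable[of _ UNIV])
  fix a
  have meas: "(\<lambda>w. increments h w k) \<in> M \<rightarrow>\<^sub>M count_space UNIV"
    using measurable_compose[OF increments_measurable[OF assms] measurable_component_singleton[of k UNIV]] by simp
  have "emeasure (distr M (count_space UNIV) (\<lambda>w. increments h w k)) {a}
      = emeasure M {w \<in> space M. N (real (Suc k) * h) w - N (real k * h) w = a}"
    by (subst emeasure_distr[OF meas]) (auto simp: increments_def intro!: arg_cong[where f="emeasure M"])
  also have "\<dots> = ennreal ((rate * h) ^ a / fact a * exp (- (rate * h)))"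
    using assms increments_poisson[of "real k * h" "real (Suc k) * h" a]
    by (simp add: emeasure_eq_measure algebra_simps)
  also have "\<dots> = emeasure (poisson_law (rate * h)) {a}"
    by (simp add: poisson_law_def emeasure_density nn_integral_count_space_indicator[symmetric])
  finally show "emeasure (distr M (count_space UNIV) (\<lambda>w. increments h w k)) {a} = emeasure (poisson_law (rate * h)) {a}" .
qed auto

lemma distr_increments:
  assumes "0 < h"
  shows "distr M (\<Pi>\<^sub>M k\<in>UNIV. count_space UNIV) (increments h) = (\<Pi>\<^sub>M k\<in>UNIV. poisson_law (rate * h))"
proof -
  have meas: "(\<lambda>w. increments h w k) \<in> M \<rightarrow>\<^sub>M count_space UNIV" for k
    using measurable_compose[OF increments_measurable[OF assms] measurable_component_singleton[of k UNIV]] by simp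
  have "indep_vars (\<lambda>_. count_space UNIV) (\<lambda>k w. increments h w k) UNIV"
    using assms increments_indep[of "\<lambda>k. real k * h"]
    by (simp add: increments_def mono_def mult_right_mono del: of_nat_Suc)
  then show ?thesis
    using indep_vars_iff_distr_eq_PiM'[of UNIV "\<lambda>k w. increments h w k" "\<lambda>_. count_space UNIV"] meas
    by (simp add: distr_increment[OF assms] restrict_UNIV)
qed

lemma distr_claims: "distr M (\<Pi>\<^sub>M k\<in>UNIV. borel) claims = (\<Pi>\<^sub>M k\<in>UNIV. F)"
proof -
  let ?X = "\<lambda>w. \<lambda>i\<in>{1..}. X i w" and ?s = "\<lambda>\<omega>. \<lambda>n\<in>(UNIV::nat set). \<omega> (Suc n)"
  have [measurable]: "?X \<in> M \<rightarrow>\<^sub>M (\<Pi>\<^sub>M i\<in>{1..}. borel)"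
    by (intro measurable_restrict X_measurable) auto
  have "distr M (\<Pi>\<^sub>M i\<in>{1..}. borel) ?X = (\<Pi>\<^sub>M i\<in>{1..}. distr M borel (X i))"
    using indep_vars_iff_distr_eq_PiM'[of "{1..}" X "\<lambda>_. borel"] X_indep X_measurable by auto
  also have "\<dots> = (\<Pi>\<^sub>M i\<in>{1..}. F)"
    by (intro PiM_cong X_distr) auto
  finally have law: "distr M (\<Pi>\<^sub>M i\<in>{1..}. borel) ?X = (\<Pi>\<^sub>M i\<in>{1..}. F)" .
  have [measurable]: "?s \<in> (\<Pi>\<^sub>M i\<in>{1..}. borel) \<rightarrow>\<^sub>M (\<Pi>\<^sub>M k\<in>UNIV. (borel :: real measure))"
    by (intro measurable_restrict measurable_component_singleton) auto
  have "distr M (\<Pi>\<^sub>M k\<in>UNIV. borel) claims = distr M (\<Pi>\<^sub>M k\<in>UNIV. borel) (?s \<circ> ?X)"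
    by (intro distr_cong) (auto simp: claims_def fun_eq_iff)
  also have "\<dots> = distr (distr M (\<Pi>\<^sub>M i\<in>{1..}. borel) ?X) (\<Pi>\<^sub>M k\<in>UNIV. borel) ?s"
    by (rule distr_distr[symmetric]) measurable
  also have "\<dots> = distr (\<Pi>\<^sub>M i\<in>{1..}. F) (\<Pi>\<^sub>M k\<in>UNIV. F) ?s"
    unfolding law by (intro distr_cong sets_PiM_cong) (auto simp: sets_F)
  also have "\<dots> = (\<Pi>\<^sub>M k\<in>UNIV. F)"
    by (rule distr_PiM_reindex[of "{1..}" "\<lambda>_. F" Suc UNIV]) (auto intro: prob_space_F)
  finally show ?thesis .
qed

text \<open>The increments are measurable for the \<sigma>-algebra generated by the claim number
  process, the claims for that of the claim sequence; these two are independent by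
  assumption.\<close>

lemma distr_increments_claims:
  assumes "0 < h"
  shows "distr M ((\<Pi>\<^sub>M k\<in>UNIV. count_space UNIV) \<Otimes>\<^sub>M (\<Pi>\<^sub>M k\<in>UNIV. borel)) (\<lambda>w. (increments h w, claims w))
    = (\<Pi>\<^sub>M k\<in>UNIV. poisson_law (rate * h)) \<Otimes>\<^sub>M (\<Pi>\<^sub>M k\<in>UNIV. F)"
proof -
  let ?N = "\<lambda>w. \<lambda>t\<in>{0::real..}. N t w" and ?X = "\<lambda>w. \<lambda>i\<in>{1::nat..}. X i w"
  let ?VN = "vimage_algebra (space M) ?N (\<Pi>\<^sub>M t\<in>{0..}. count_space UNIV)"
  let ?VX = "vimage_algebra (space M) ?X (\<Pi>\<^sub>M i\<in>{1..}. borel)"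
  have N: "?N \<in> ?VN \<rightarrow>\<^sub>M (\<Pi>\<^sub>M t\<in>{0..}. count_space UNIV)"
    by (rule measurable_vimage_algebra1) (auto simp: space_PiM)
  have X: "?X \<in> ?VX \<rightarrow>\<^sub>M (\<Pi>\<^sub>M i\<in>{1..}. borel)"
    by (rule measurable_vimage_algebra1) (auto simp: space_PiM)
  have Nt: "N t \<in> ?VN \<rightarrow>\<^sub>M count_space UNIV" if "0 \<le> t" for t
    using measurable_compose[OF N measurable_component_singleton[of t]] that by simp
  have Xi: "X i \<in> borel_measurable ?VX" if "1 \<le> i" for i
    using measurable_compose[OF X measurable_component_singleton[of i]] that by simp
  have D: "increments h \<in> ?VN \<rightarrow>\<^sub>M (\<Pi>\<^sub>M k\<in>UNIV. count_space UNIV)"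
  proof (rule measurable_PiM_single')
    show "(\<lambda>w. increments h w k) \<in> ?VN \<rightarrow>\<^sub>M count_space UNIV" for k
    proof -
      have [measurable]: "N (real j * h) \<in> ?VN \<rightarrow>\<^sub>M count_space UNIV" for j
        using assms by (intro Nt) auto
      show ?thesis unfolding increments_def by measurable
    qed
  qed auto
  have Y: "claims \<in> ?VX \<rightarrow>\<^sub>M (\<Pi>\<^sub>M k\<in>UNIV. borel)"
    by (rule measurable_PiM_single') (auto simp: claims_def simp del: One_nat_def intro!: Xi)
  show ?thesis
    unfolding distr_increments[OF assms, symmetric] distr_claims[symmetric]
    by (rule distr_Pair_indep_set[OF increments_measurable[OF assms] claims_measurable N_X_indep])
      (use measurable_sets[OF D] measurable_sets[OF Y] in simp_all)
qed

lemma nn_integral_grid_law: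
  assumes "0 < h"
    and f: "f \<in> borel_measurable ((\<Pi>\<^sub>M k\<in>UNIV. count_space UNIV) \<Otimes>\<^sub>M (\<Pi>\<^sub>M k\<in>UNIV. borel))"
  shows "(\<integral>\<^sup>+w. f (increments h w, claims w) \<partial>M) =
    (\<integral>\<^sup>+d. \<integral>\<^sup>+y. f (d, y) \<partial>(\<Pi>\<^sub>M k\<in>UNIV. F) \<partial>(\<Pi>\<^sub>M k\<in>UNIV. poisson_law (rate * h)))"
proof -
  interpret F: sequence_space F by (rule sequence_spaceI[OF prob_space_F])
  let ?D = "\<Pi>\<^sub>M k\<in>(UNIV::nat set). count_space (UNIV::nat set)" and ?Y = "\<Pi>\<^sub>M k\<in>(UNIV::nat set). (borel :: real measure)"
  note [measurable] = f increments_measurable[OF assms(1)] claims_measurable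
  have [measurable_cong]: "sets (\<Pi>\<^sub>M k\<in>UNIV. poisson_law (rate * h)) = sets ?D" "sets F.S = sets ?Y"
    by (intro sets_PiM_cong; simp add: sets_F)+
  have "(\<integral>\<^sup>+w. f (increments h w, claims w) \<partial>M) = (\<integral>\<^sup>+p. f p \<partial>distr M (?D \<Otimes>\<^sub>M ?Y) (\<lambda>w. (increments h w, claims w)))"
    by (subst nn_integral_distr) measurable
  also have "distr M (?D \<Otimes>\<^sub>M ?Y) (\<lambda>w. (increments h w, claims w)) = (\<Pi>\<^sub>M k\<in>UNIV. poisson_law (rate * h)) \<Otimes>\<^sub>M F.S"
    by (rule distr_increments_claims[OF assms(1)])
  also have "(\<integral>\<^sup>+p. f p \<partial>\<dots>) = (\<integral>\<^sup>+d. \<integral>\<^sup>+y. f (d, y) \<partial>F.S \<partial>(\<Pi>\<^sub>M k\<in>UNIV. poisson_law (rate * h)))"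
    by (rule F.P.nn_integral_fst[symmetric]) measurable
  finally show ?thesis .
qed

text \<open>The condition \<open>adj\<close> is an inequality so that \<open>r\<close> may be the
  adjustment coefficient of a larger intensity. The grid bound is uniform in horizon and mesh, and
  both limits preserve it.\<close>

theorem lundberg_inequality:
  assumes c: "0 < c" and u: "0 \<le> u" and r: "0 \<le> r"
    and int: "integrable F (\<lambda>x. exp (r * x))"
    and adj: "rate * ((LINT x|F. exp (r * x)) - 1) \<le> c * r"
  shows "prob {w \<in> space M. ruin_time c N X u w < \<infinity>} \<le> exp (- r * u)"
proof -
  let ?m = "LINT x|F. exp (r * x)"
  let ?E = "\<lambda>m n. {w \<in> space M. \<exists>k\<le>n. grid_path c N X u m w k < 0}"
  note [measurable] = ruin_event_pred[OF c u]
  have bound: "emeasure M (?E m n) \<le> ennreal (exp (- r * u))" for m n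
  proof -
    define h where "h = 1 / real (Suc m)"
    have h: "0 < h" by (simp add: h_def)
    have "emeasure M (?E m n) = (\<integral>\<^sup>+w. indicator (?E m n) w \<partial>M)"
      by simp
    also have "\<dots> = (\<integral>\<^sup>+w. of_bool (\<exists>k\<le>n. grid_surplus u (c * h) (fst (increments h w, claims w)) (snd (increments h w, claims w)) k < 0) \<partial>M)"
      using grid_path_eq_grid_surplus[of _ c u m]
      by (intro nn_integral_cong) (auto simp: indicator_def h_def simp del: of_nat_Suc)
    also have "\<dots> = (\<integral>\<^sup>+d. \<integral>\<^sup>+y. of_bool (\<exists>k\<le>n. grid_surplus u (c * h) (fst (d, y)) (snd (d, y)) k < 0)
        \<partial>(\<Pi>\<^sub>M k\<in>UNIV. F) \<partial>(\<Pi>\<^sub>M k\<in>UNIV. poisson_law (rate * h)))"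
      by (rule nn_integral_grid_law[OF h]) measurable
    also have "\<dots> = (\<integral>\<^sup>+d. \<integral>\<^sup>+y. indicator {y. \<exists>k\<le>n. grid_surplus u (c * h) d y k < 0} y
        \<partial>(\<Pi>\<^sub>M k\<in>UNIV. F) \<partial>(\<Pi>\<^sub>M k\<in>UNIV. poisson_law (rate * h)))"
      by (intro nn_integral_cong) (simp add: indicator_def)
    also have "\<dots> \<le> ennreal (exp (- r * u))"
    proof (rule grid_lundberg)
      show "(\<integral>\<^sup>+x. ennreal (exp (r * x)) \<partial>F) = ennreal ?m"
        using int by (intro nn_integral_eq_integral) auto
      show "rate * h * (?m - 1) \<le> r * (c * h)"
        using mult_right_mono[OF adj, of h] h by (simp add: ac_simps)
    qed (use h rate_nonneg r prob_space_F sets_F in auto)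
    finally show ?thesis .
  qed
  \<comment> \<open>The horizon tends to infinity at fixed mesh, by continuity from below.\<close>
  have ruin: "emeasure M (\<Union>n. ?E m n) \<le> ennreal (exp (- r * u))" for m
  proof -
    have "(SUP n. emeasure M (?E m n)) = emeasure M (\<Union>n. ?E m n)"
      by (intro SUP_emeasure_incseq) (auto simp: incseq_def intro: order_trans)
    moreover have "(SUP n. emeasure M (?E m n)) \<le> ennreal (exp (- r * u))"
      by (intro SUP_least bound)
    ultimately show ?thesis by simp
  qed
  \<comment> \<open>Grids of mesh \<open>1 / (m + 1)\<close> are not nested, so these events need
    not increase with \<open>m\<close>. A ruined path lies in all but finitely many of them, and
    Fatou's lemma applies.\<close>
  have "emeasure M {w \<in> space M. ruin_time c N X u w < \<infinity>}
      \<le> (\<integral>\<^sup>+w. liminf (\<lambda>m. indicator (\<Union>n. ?E m n) w) \<partial>M)"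
  proof (subst nn_integral_indicator[symmetric], measurable, intro nn_integral_mono)
    fix w assume w: "w \<in> space M"
    then interpret risk_path c u N X w using c u by (intro risk_pathI)
    show "indicator {w \<in> space M. ruin_time c N X u w < \<infinity>} w \<le> (liminf (\<lambda>m. indicator (\<Union>n. ?E m n) w) :: ennreal)"
    proof (cases "T < \<infinity>")
      case True
      then have "eventually (\<lambda>m. w \<in> (\<Union>n. ?E m n)) sequentially"
        using grid_approximation(1) w by (auto elim!: eventually_mono)
      then have "eventually (\<lambda>m. 1 \<le> (indicator (\<Union>n. ?E m n) w :: ennreal)) sequentially"
        by eventually_elim simp
      then show ?thesis using w True by (auto intro!: Liminf_bounded)
    qed simp
  qed
  also have "\<dots> \<le> liminf (\<lambda>m. (\<integral>\<^sup>+w. indicator (\<Union>n. ?E m n) w \<partial>M))"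
    by (rule nn_integral_liminf) measurable
  also have "\<dots> = liminf (\<lambda>m. emeasure M (\<Union>n. ?E m n))"
    by (subst nn_integral_indicator) auto
  also have "\<dots> \<le> ennreal (exp (- r * u))"
    using ruin by (intro Liminf_le) (auto intro!: always_eventually)
  finally show ?thesis
    by (simp add: emeasure_eq_measure)
qed

end

section \<open>Comparison of deficit laws\<close>

definition ruin_functional ::
    "real \<Rightarrow> (real \<Rightarrow> 'w \<Rightarrow> nat) \<Rightarrow> (nat \<Rightarrow> 'w \<Rightarrow> real) \<Rightarrow> real \<Rightarrow> nat \<Rightarrow> (real \<Rightarrow> real) \<Rightarrow> 'w \<Rightarrow> real"
  where "ruin_functional c N X u \<tau> \<phi> w =
    (if ruin_time c N X u w < \<infinity>
     then \<phi> (deficit c N X u w) * cutoff \<tau> (real_of_ereal (ruin_time c N X u w)) else 0)"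

context cramer_lundberg
begin

lemma ruin_functional_measurable:
  assumes "0 < c" "0 \<le> u" and [measurable]: "\<phi> \<in> borel_measurable borel"
  shows "ruin_functional c N X u \<tau> \<phi> \<in> borel_measurable M"
proof -
  note [measurable] = ruin_event_pred[OF assms(1,2)] deficit_measurable[OF assms(1,2)] ruin_time_measurable[OF assms(1,2)]
  have "ruin_functional c N X u \<tau> \<phi> = (\<lambda>w. if ruin_time c N X u w < \<infinity>
      then \<phi> (if ruin_time c N X u w < \<infinity> then deficit c N X u w else 0) *
        cutoff \<tau> (if ruin_time c N X u w < \<infinity> then real_of_ereal (ruin_time c N X u w) else 0) else 0)"
    by (auto simp: ruin_functional_def)
  then show ?thesis by (simp only:) measurable
qed

lemma nn_integral_grid_functional:
  assumes [measurable]: "\<phi> \<in> borel_measurable borel"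
  shows "(\<integral>\<^sup>+w. ennreal (grid_functional \<tau> \<phi> m (grid_path c N X u m w)) \<partial>M) =
    (\<integral>\<^sup>+d. \<integral>\<^sup>+y. ennreal (grid_functional \<tau> \<phi> m (grid_surplus u (c / real (Suc m)) d y))
      \<partial>(\<Pi>\<^sub>M k\<in>UNIV. F) \<partial>(\<Pi>\<^sub>M k\<in>UNIV. poisson_law (rate / real (Suc m))))"
proof -
  let ?f = "\<lambda>p. ennreal (grid_functional \<tau> \<phi> m (grid_surplus u (c / real (Suc m)) (fst p) (snd p)))"
  have "(\<integral>\<^sup>+w. ennreal (grid_functional \<tau> \<phi> m (grid_path c N X u m w)) \<partial>M) =
      (\<integral>\<^sup>+w. ?f (increments (1 / real (Suc m)) w, claims w) \<partial>M)"
    by (intro nn_integral_cong arg_cong[where f=ennreal] grid_functional_cong)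
      (simp add: grid_path_eq_grid_surplus del: of_nat_Suc)
  also have "\<dots> = (\<integral>\<^sup>+d. \<integral>\<^sup>+y. ?f (d, y)
      \<partial>(\<Pi>\<^sub>M k\<in>UNIV. F) \<partial>(\<Pi>\<^sub>M k\<in>UNIV. poisson_law (rate * (1 / real (Suc m)))))"
    by (rule nn_integral_grid_law) (simp, measurable)
  finally show ?thesis by simp
qed

lemma nn_integral_grid_functional_tendsto:
  assumes "0 < c" "0 \<le> u" "continuous_on UNIV \<phi>" "\<And>y. 0 \<le> \<phi> y" "\<And>y. \<phi> y \<le> 1"
  shows "(\<lambda>m. \<integral>\<^sup>+w. ennreal (grid_functional \<tau> \<phi> m (grid_path c N X u m w)) \<partial>M)
    \<longlonglongrightarrow> (\<integral>\<^sup>+w. ennreal (ruin_functional c N X u \<tau> \<phi> w) \<partial>M)"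
proof (rule nn_integral_dominated_convergence[where w = "\<lambda>_. 1"])
  have [measurable]: "\<phi> \<in> borel_measurable borel"
    using assms(3) by (rule borel_measurable_continuous_onI)
  note [measurable] = ruin_functional_measurable[OF assms(1,2)]
  show "(\<lambda>w. ennreal (grid_functional \<tau> \<phi> m (grid_path c N X u m w))) \<in> borel_measurable M" for m
    by measurable
  show "(\<lambda>w. ennreal (ruin_functional c N X u \<tau> \<phi> w)) \<in> borel_measurable M"
    by measurable
  have "grid_functional \<tau> \<phi> m s \<le> 1" for m s
    using assms(4,5) cutoff_bounds by (auto simp: grid_functional_def intro!: mult_le_one)
  then show "AE w in M. ennreal (grid_functional \<tau> \<phi> m (grid_path c N X u m w)) \<le> 1" for m
    by simp
  show "AE w in M. (\<lambda>m. ennreal (grid_functional \<tau> \<phi> m (grid_path c N X u m w)))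
      \<longlonglongrightarrow> ennreal (ruin_functional c N X u \<tau> \<phi> w)"
  proof (intro AE_I2 tendsto_ennrealI)
    fix w assume "w \<in> space M"
    then interpret risk_path c u N X w using assms by (intro risk_pathI)
    show "(\<lambda>m. grid_functional \<tau> \<phi> m (grid_path c N X u m w)) \<longlonglongrightarrow> ruin_functional c N X u \<tau> \<phi> w"
      using grid_functional_tendsto[OF assms(3)] by (simp add: ruin_functional_def)
  qed
qed (simp_all add: emeasure_space_1)

end

text \<open>Up to the horizon \<open>\<tau>\<close> the increments for the rate \<open>l \<le> l'\<close> have a density of at
  most \<open>exp ((l' - l) * \<tau>)\<close> with respect to those for \<open>l'\<close>, uniformly in the mesh of the grid.\<close>

lemma ruin_functional_dominated:
  assumes CL: "cramer_lundberg M N l X F" "cramer_lundberg M' N l' X F"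
    and l: "l \<le> l'" and c: "0 < c" "0 \<le> u"
    and \<phi>: "continuous_on UNIV \<phi>" "\<And>y. 0 \<le> \<phi> y" "\<And>y. \<phi> y \<le> 1"
  shows "(\<integral>\<^sup>+w. ennreal (ruin_functional c N X u \<tau> \<phi> w) \<partial>M)
    \<le> ennreal (exp ((l' - l) * real \<tau>)) * (\<integral>\<^sup>+w. ennreal (ruin_functional c N X u \<tau> \<phi> w) \<partial>M')"
proof (rule LIMSEQ_le)
  interpret A: cramer_lundberg M N l X F by fact
  interpret B: cramer_lundberg M' N l' X F by fact
  have [measurable]: "\<phi> \<in> borel_measurable borel"
    using \<phi>(1) by (rule borel_measurable_continuous_onI)
  let ?I = "\<lambda>M m. \<integral>\<^sup>+w. ennreal (grid_functional \<tau> \<phi> m (grid_path c N X u m w)) \<partial>M"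
  show "?I M \<longlonglongrightarrow> (\<integral>\<^sup>+w. ennreal (ruin_functional c N X u \<tau> \<phi> w) \<partial>M)"
    by (rule A.nn_integral_grid_functional_tendsto[OF c \<phi>])
  show "(\<lambda>m. ennreal (exp ((l' - l) * real \<tau>)) * ?I M' m)
      \<longlonglongrightarrow> ennreal (exp ((l' - l) * real \<tau>)) * (\<integral>\<^sup>+w. ennreal (ruin_functional c N X u \<tau> \<phi> w) \<partial>M')"
    by (intro ennreal_tendsto_cmult B.nn_integral_grid_functional_tendsto[OF c \<phi>]) simp
  interpret F: sequence_space F by (rule sequence_spaceI[OF A.prob_space_F])
  have [measurable_cong]: "sets F.S = sets (\<Pi>\<^sub>M i\<in>UNIV. borel)"
    by (intro sets_PiM_cong; simp add: A.sets_F)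
  have "?I M m \<le> ennreal (exp ((l' - l) * real \<tau>)) * ?I M' m" for m
  proof -
    let ?f = "\<lambda>d. \<integral>\<^sup>+y. ennreal (grid_functional \<tau> \<phi> m (grid_surplus u (c / real (Suc m)) d y)) \<partial>F.S"
    have "?I M m = (\<integral>\<^sup>+d. ?f d \<partial>(\<Pi>\<^sub>M k\<in>UNIV. poisson_law (l / real (Suc m))))"
      by (rule A.nn_integral_grid_functional) measurable
    also have "\<dots> \<le> ennreal (exp (l' / real (Suc m) - l / real (Suc m))) ^ (\<tau> * Suc m) *
        (\<integral>\<^sup>+d. ?f d \<partial>(\<Pi>\<^sub>M k\<in>UNIV. poisson_law (l' / real (Suc m))))"
    proof (rule PiM_poisson_law_dominated)
      show "0 \<le> l / real (Suc m)" "l / real (Suc m) \<le> l' / real (Suc m)"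
        using A.rate_nonneg l by (auto intro: divide_right_mono)
      show "?f \<in> borel_measurable (\<Pi>\<^sub>M i\<in>UNIV. count_space UNIV)"
        by measurable
      \<comment> \<open>The surplus at the first \<open>\<tau> * Suc m\<close> grid steps involves
        exactly that many increments.\<close>
      fix d d' :: "nat \<Rightarrow> nat" assume eq: "\<And>j. j < \<tau> * Suc m \<Longrightarrow> d j = d' j"
      have "grid_surplus u e d y k = grid_surplus u e d' y k" if "k \<le> \<tau> * Suc m" for e y k
      proof -
        have "(\<Sum>j<k. d j) = (\<Sum>j<k. d' j)"
          using that by (intro sum.cong refl eq) auto
        then show ?thesis by (simp add: grid_surplus_def)
      qed
      then show "?f d = ?f d'"
        by (intro nn_integral_cong arg_cong[where f=ennreal] grid_functional_cong)
    qed
    also have "(\<integral>\<^sup>+d. ?f d \<partial>(\<Pi>\<^sub>M k\<in>UNIV. poisson_law (l' / real (Suc m)))) = ?I M' m"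
      by (rule B.nn_integral_grid_functional[symmetric]) measurable
    \<comment> \<open>The number of cells is proportional to \<open>Suc m\<close> and the exponent
      per cell to its inverse, so the mesh cancels.\<close>
    also have "ennreal (exp (l' / real (Suc m) - l / real (Suc m))) ^ (\<tau> * Suc m) = ennreal (exp ((l' - l) * real \<tau>))"
    proof -
      have "real (\<tau> * Suc m) * (l' / real (Suc m) - l / real (Suc m)) = (l' - l) * real \<tau>"
        unfolding of_nat_mult diff_divide_distrib[symmetric] by (simp del: of_nat_Suc)
      then show ?thesis
        unfolding ennreal_power[OF exp_ge_zero] exp_of_nat_mult[symmetric] by simp
    qed
    finally show ?thesis .
  qed
  then show "\<exists>k. \<forall>m\<ge>k. ?I M m \<le> ennreal (exp ((l' - l) * real \<tau>)) * ?I M' m"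
    by blast
qed

text \<open>On an open set the functions \<open>min 1 (k * distance to the complement)\<close> are
  eventually 1, and outside they vanish; Fatou's lemma carries the inequality from test functions to
  the set.\<close>

lemma emeasure_le_open:
  fixes \<mu> \<nu> :: "real measure"
  assumes sets: "sets \<mu> = sets borel" "sets \<nu> = sets borel"
    and le: "\<And>\<phi>. continuous_on UNIV \<phi> \<Longrightarrow> (\<And>y. 0 \<le> \<phi> y) \<Longrightarrow> (\<And>y. \<phi> y \<le> 1) \<Longrightarrow>
      (\<integral>\<^sup>+y. ennreal (\<phi> y) \<partial>\<mu>) \<le> C * (\<integral>\<^sup>+y. ennreal (\<phi> y) \<partial>\<nu>)"
    and O: "open S"
  shows "emeasure \<mu> S \<le> C * emeasure \<nu> S"
\<comment> \<open>The distance to the empty complement is 0 by default, so the approximation below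
  would fail for the whole line.\<close>
proof (cases "S = UNIV")
  case True
  have "space \<mu> = UNIV" "space \<nu> = UNIV"
    using sets_eq_imp_space_eq[OF sets(1)] sets_eq_imp_space_eq[OF sets(2)] by simp_all
  then show ?thesis
    using le[of "\<lambda>_. 1"] True by simp
next
  case False
  note [measurable_cong] = sets
  have [measurable]: "S \<in> sets borel" using O by simp
  define \<phi> where "\<phi> k y = min 1 (real k * infdist y (- S))" for k y
  have \<phi>: "continuous_on UNIV (\<phi> k)" "0 \<le> \<phi> k y" "\<phi> k y \<le> 1" for k y
    unfolding \<phi>_def by (auto intro!: continuous_intros infdist_nonneg mult_nonneg_nonneg)
  have [measurable]: "\<phi> k \<in> borel_measurable borel" for k
    using \<phi>(1) by (rule borel_measurable_continuous_onI)
  have "emeasure \<mu> S = (\<integral>\<^sup>+y. indicator S y \<partial>\<mu>)"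
    by simp
  also have "\<dots> \<le> (\<integral>\<^sup>+y. liminf (\<lambda>k. ennreal (\<phi> k y)) \<partial>\<mu>)"
  proof (intro nn_integral_mono)
    fix y
    show "indicator S y \<le> liminf (\<lambda>k. ennreal (\<phi> k y))"
    proof (cases "y \<in> S")
      case True
      then have pos: "0 < infdist y (- S)"
        using O False by (intro infdist_pos_not_in_closed) auto
      have "\<forall>\<^sub>F k in sequentially. 1 \<le> ennreal (\<phi> k y)"
        using eventually_ge_at_top[of "nat \<lceil>1 / infdist y (- S)\<rceil>"]
      proof eventually_elim
        case (elim k)
        then have "1 / infdist y (- S) \<le> real k" by linarith
        then have "\<phi> k y = 1" using pos by (simp add: \<phi>_def field_simps)
        then show ?case by simp
      qed
      then show ?thesis using True by (auto intro!: Liminf_bounded)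
    qed simp
  qed
  also have "\<dots> \<le> liminf (\<lambda>k. \<integral>\<^sup>+y. ennreal (\<phi> k y) \<partial>\<mu>)"
    by (rule nn_integral_liminf) measurable
  also have "\<dots> \<le> C * emeasure \<nu> S"
  proof (intro Liminf_le always_eventually allI)
    fix k
    have "ennreal (\<phi> k y) \<le> indicator S y" for y
      using \<phi>(3)[of k y] by (auto simp: \<phi>_def indicator_def)
    then have \<nu>: "(\<integral>\<^sup>+y. ennreal (\<phi> k y) \<partial>\<nu>) \<le> (\<integral>\<^sup>+y. indicator S y \<partial>\<nu>)"
      by (intro nn_integral_mono)
    have "(\<integral>\<^sup>+y. ennreal (\<phi> k y) \<partial>\<mu>) \<le> C * (\<integral>\<^sup>+y. ennreal (\<phi> k y) \<partial>\<nu>)"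
      by (intro le \<phi>)
    also have "\<dots> \<le> C * (\<integral>\<^sup>+y. indicator S y \<partial>\<nu>)"
      using \<nu> by (rule mult_left_mono) simp
    finally show "(\<integral>\<^sup>+y. ennreal (\<phi> k y) \<partial>\<mu>) \<le> C * emeasure \<nu> S"
      by simp
  qed simp
  finally show ?thesis .
qed

text \<open>By outer regularity a \<open>\<nu>\<close>-null set has open neighbourhoods of
  arbitrarily small \<open>\<nu>\<close>-measure, and for open sets the domination is available. A
  factor of the form \<open>exp x\<close> can be inverted to the other side.\<close>

lemma emeasure_zero_of_dominated:
  fixes \<mu> \<nu> :: "real measure"
  assumes sets: "sets \<mu> = sets borel" "sets \<nu> = sets borel" and fin: "finite_measure \<mu>" "finite_measure \<nu>"
    and le: "\<And>\<phi>. continuous_on UNIV \<phi> \<Longrightarrow> (\<And>y. 0 \<le> \<phi> y) \<Longrightarrow> (\<And>y. \<phi> y \<le> 1) \<Longrightarrow>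
      (\<integral>\<^sup>+y. ennreal (\<phi> y) \<partial>\<mu>) \<le> ennreal (exp x) * (\<integral>\<^sup>+y. ennreal (\<phi> y) \<partial>\<nu>)"
    and A: "A \<in> sets borel" "emeasure \<nu> A = 0"
  shows "emeasure \<mu> A = 0"
proof -
  have "ennreal (exp (- x)) * emeasure \<mu> A \<le> emeasure \<nu> U" if U: "A \<subseteq> U" "open U" for U
  proof -
    have "emeasure \<mu> A \<le> emeasure \<mu> U"
      using U sets by (intro emeasure_mono) auto
    also have "\<dots> \<le> ennreal (exp x) * emeasure \<nu> U"
      by (rule emeasure_le_open[OF sets le U(2)])
    finally have "ennreal (exp (- x)) * emeasure \<mu> A \<le> ennreal (exp (- x)) * (ennreal (exp x) * emeasure \<nu> U)"
      by (intro mult_left_mono) auto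
    also have "\<dots> = emeasure \<nu> U"
      by (simp add: mult.assoc[symmetric] flip: ennreal_mult exp_add)
    finally show ?thesis .
  qed
  then have "ennreal (exp (- x)) * emeasure \<mu> A \<le> (INF U \<in> {U. A \<subseteq> U \<and> open U}. emeasure \<nu> U)"
    by (intro INF_greatest) auto
  also have "\<dots> = 0"
    using outer_regular[OF sets(2) _ A(1)] A(2) finite_measure.emeasure_finite[OF fin(2)] by simp
  finally show ?thesis by simp
qed

text \<open>Absolute continuity horizon by horizon: deficit laws weighted by the cutoff are
  dominated with a constant depending on \<open>\<tau>\<close>, and every ruined path has weight 1
  for some \<open>\<tau>\<close>.\<close>

lemma ruin_deficit_null_transfer:
  assumes CL: "cramer_lundberg M N l X F" "cramer_lundberg M' N l' X F"
    and l: "l \<le> l'" and c: "0 < c" "0 \<le> u" and A: "A \<in> sets borel"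
    and null: "AE w in M'. ruin_time c N X u w < \<infinity> \<longrightarrow> deficit c N X u w \<notin> A"
  shows "AE w in M. ruin_time c N X u w < \<infinity> \<longrightarrow> deficit c N X u w \<notin> A"
proof -
  interpret A: cramer_lundberg M N l X F by fact
  interpret B: cramer_lundberg M' N l' X F by fact
  note A [measurable]
  let ?T = "ruin_time c N X u"
  let ?D = "\<lambda>w. if ?T w < \<infinity> then deficit c N X u w else 0"
  let ?w = "\<lambda>\<tau> w. ennreal (ruin_functional c N X u \<tau> (\<lambda>_. 1) w)"
  \<comment> \<open>Paths without ruin carry weight 0, so the default value 0 in \<open>?D\<close>
    contributes no mass.\<close>
  define \<mu> where "\<mu> \<tau> M = distr (density M (?w \<tau>)) borel ?D" for \<tau> M
  have w_le: "?w \<tau> w \<le> 1" for \<tau> w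
    by (auto simp: ruin_functional_def cutoff_bounds)
  have nn: "(\<integral>\<^sup>+y. f y \<partial>\<mu> \<tau> L) = (\<integral>\<^sup>+w. ?w \<tau> w * f (?D w) \<partial>L)"
    if "cramer_lundberg L N k X F" and [measurable]: "f \<in> borel_measurable borel" for f \<tau> L k
  proof -
    interpret L: cramer_lundberg L N k X F by fact
    note [measurable] = L.deficit_measurable[OF c] L.ruin_functional_measurable[OF c]
    have D: "?D \<in> density L (?w \<tau>) \<rightarrow>\<^sub>M borel"
      by measurable
    have w: "(\<lambda>w. ?w \<tau> w) \<in> borel_measurable L" "(\<lambda>w. f (?D w)) \<in> borel_measurable L"
      by measurable
    have f: "f \<in> borel_measurable (distr (density L (?w \<tau>)) borel ?D)"
      by measurable
    show ?thesis
      unfolding \<mu>_def nn_integral_distr[OF D f] by (rule nn_integral_density[OF w])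
  qed
  have fin: "finite_measure (\<mu> \<tau> L)" if "cramer_lundberg L N k X F" for \<tau> L k
  proof -
    interpret L: cramer_lundberg L N k X F by fact
    have "emeasure (\<mu> \<tau> L) (space (\<mu> \<tau> L)) = (\<integral>\<^sup>+w. ?w \<tau> w \<partial>L)"
      using nn[OF that, of "\<lambda>_. 1" \<tau>] by simp
    also have "\<dots> \<le> (\<integral>\<^sup>+w. 1 \<partial>L)"
      by (intro nn_integral_mono w_le)
    also have "\<dots> < \<infinity>" by (simp add: L.emeasure_space_1)
    finally show ?thesis by (intro finite_measureI) auto
  qed
  have zero: "emeasure (\<mu> \<tau> M) A = 0" for \<tau>
  proof (rule emeasure_zero_of_dominated[where \<nu> = "\<mu> \<tau> M'" and x = "(l' - l) * real \<tau>"])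
    fix \<phi> :: "real \<Rightarrow> real"
    assume \<phi>: "continuous_on UNIV \<phi>" "\<And>y. 0 \<le> \<phi> y" "\<And>y. \<phi> y \<le> 1"
    then have [measurable]: "\<phi> \<in> borel_measurable borel"
      by (intro borel_measurable_continuous_onI)
    have "(\<integral>\<^sup>+y. ennreal (\<phi> y) \<partial>\<mu> \<tau> L) = (\<integral>\<^sup>+w. ennreal (ruin_functional c N X u \<tau> \<phi> w) \<partial>L)"
      if "cramer_lundberg L N k X F" for L k
      by (subst nn[OF that], measurable, intro nn_integral_cong)
        (auto simp: ruin_functional_def \<phi> cutoff_bounds mult.commute simp flip: ennreal_mult)
    then show "(\<integral>\<^sup>+y. ennreal (\<phi> y) \<partial>\<mu> \<tau> M) \<le> ennreal (exp ((l' - l) * real \<tau>)) * (\<integral>\<^sup>+y. ennreal (\<phi> y) \<partial>\<mu> \<tau> M')"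
      using ruin_functional_dominated[OF CL l c \<phi>, of \<tau>] CL by simp
  next
    have "emeasure (\<mu> \<tau> M') A = (\<integral>\<^sup>+y. indicator A y \<partial>\<mu> \<tau> M')"
      using A by (simp add: \<mu>_def)
    also have "\<dots> = (\<integral>\<^sup>+w. ?w \<tau> w * indicator A (?D w) \<partial>M')"
      using A by (intro nn[OF CL(2)]) measurable
    also have "\<dots> = (\<integral>\<^sup>+w. 0 \<partial>M')"
      using null by (intro nn_integral_cong_AE) (auto elim!: eventually_mono simp: ruin_functional_def)
    finally show "emeasure (\<mu> \<tau> M') A = 0" by simp
  qed (use A fin[OF CL(1)] fin[OF CL(2)] in \<open>auto simp: \<mu>_def\<close>)
  have "AE w in M. ?w \<tau> w * indicator A (?D w) = 0" for \<tau>
  proof -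
    note [measurable] = A.deficit_measurable[OF c] A.ruin_functional_measurable[OF c] A
    have "(\<integral>\<^sup>+w. ?w \<tau> w * indicator A (?D w) \<partial>M) = (\<integral>\<^sup>+y. indicator A y \<partial>\<mu> \<tau> M)"
      using A by (intro nn[OF CL(1), symmetric]) measurable
    also have "\<dots> = 0"
      using zero[of \<tau>] A by (simp add: \<mu>_def)
    finally show ?thesis
      by (subst (asm) nn_integral_0_iff_AE) measurable
  qed
  then have "AE w in M. \<forall>\<tau>. ?w \<tau> w * indicator A (?D w) = 0"
    unfolding AE_all_countable by blast
  then show ?thesis
  proof eventually_elim
    case (elim w)
    show ?case
    proof
      assume T: "?T w < \<infinity>"
      \<comment> \<open>One unit beyond the ruin time the cutoff has reached 1.\<close>
      obtain \<tau> :: nat where "real_of_ereal (?T w) + 1 \<le> real \<tau>"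
        using real_arch_simple by blast
      then have "?w \<tau> w = 1" using T by (simp add: ruin_functional_def cutoff_def)
      then show "deficit c N X u w \<notin> A"
        using elim[rule_format, of \<tau>] T by (auto simp: indicator_def split: if_splits)
    qed
  qed
qed

section \<open>Asymptotics of mixtures\<close>

lemma has_density_on_subset:
  "has_density_on G g S \<Longrightarrow> S' \<subseteq> S \<Longrightarrow> has_density_on G g S'"
  unfolding has_density_on_def by (auto intro: measurable_restrict_mono)

text \<open>The density is measurable on \<open>S\<close> and describes \<open>G\<close> on subsets
  of \<open>S\<close>; multiplying by the indicator gives a Borel function on the line and an
  equality of measures.\<close>

lemma has_density_on_density_eq:
  assumes dens: "has_density_on G g S" and G: "sets G = sets borel" and S: "S \<in> sets borel"
  shows "(\<lambda>l. indicator S l * g l) \<in> borel_measurable borel"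
    and "density G (indicator S) = density lborel (\<lambda>l. ennreal (indicator S l * g l))"
proof -
  show meas: "(\<lambda>l. indicator S l * g l) \<in> borel_measurable borel"
    using dens S borel_measurable_restrict_space_iff[of S borel g]
    by (simp add: has_density_on_def)
  show "density G (indicator S) = density lborel (\<lambda>l. ennreal (indicator S l * g l))"
  proof (rule measure_eqI)
    fix A assume "A \<in> sets (density G (indicator S))"
    then have A: "A \<in> sets borel" using G by simp
    have "emeasure (density G (indicator S)) A = emeasure G (A \<inter> S)"
      using A S G by (subst emeasure_density) (simp_all flip: indicator_inter_arith add: Int_commute)
    also have "\<dots> = (\<integral>\<^sup>+l\<in>A \<inter> S. ennreal (g l) \<partial>lborel)"
      using dens A S by (simp add: has_density_on_def)
    also have "\<dots> = (\<integral>\<^sup>+l\<in>A. ennreal (indicator S l * g l) \<partial>lborel)"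
      by (intro nn_integral_cong) (auto simp: indicator_def)
    also have "\<dots> = emeasure (density lborel (\<lambda>l. ennreal (indicator S l * g l))) A"
      using A meas by (subst emeasure_density) auto
    finally show "emeasure (density G (indicator S)) A = \<dots>" .
  qed (simp add: G)
qed

lemma integral_has_density_on:
  fixes f :: "real \<Rightarrow> real"
  assumes dens: "has_density_on G g S" and G: "sets G = sets borel" and S: "S \<in> sets borel"
    and f: "f \<in> borel_measurable borel"
  shows "(LINT l|G. indicator S l * f l) = (LINT l|lborel. indicator S l * g l * f l)"
proof -
  note [measurable] = has_density_on_density_eq(1)[OF dens G S] S f
  note [measurable_cong] = G
  have "(LINT l|G. indicator S l * f l) = integral\<^sup>L (density G (\<lambda>l. ennreal (indicator S l))) f"
    by (subst integral_density) auto
  also have "(\<lambda>l. ennreal (indicator S l)) = indicator S"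
    by (auto simp: indicator_def)
  also have "integral\<^sup>L (density G (indicator S)) f = (LINT l|lborel. indicator S l * g l * f l)"
    unfolding has_density_on_density_eq(2)[OF dens G S]
    by (subst integral_density) (use dens in \<open>auto simp: has_density_on_def split: split_indicator\<close>)
  finally show ?thesis .
qed

lemma has_bochner_integral_Gamma:
  assumes "0 < (b :: real)"
  shows "has_bochner_integral lborel (\<lambda>t. indicator {0<..} t * (t powr (b - 1) * exp (- t))) (Gamma b)"
proof (rule has_bochner_integral_nn_integral)
  have "(\<integral>\<^sup>+t. ennreal (indicator {0<..} t * (t powr (b - 1) * exp (- t))) \<partial>lborel)
      = (\<integral>\<^sup>+t. ennreal (indicator {0..} t * t powr (b - 1) / exp t) \<partial>lborel)"
    by (intro nn_integral_cong arg_cong[where f=ennreal]) (auto simp: indicator_def exp_minus field_simps)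
  then show "(\<integral>\<^sup>+t. ennreal (indicator {0<..} t * (t powr (b - 1) * exp (- t))) \<partial>lborel) = ennreal (Gamma b)"
    by (simp add: Gamma_conv_nn_integral_real[OF assms])
qed (use assms in \<open>auto intro: Gamma_real_pos less_imp_le\<close>)

text \<open>Scaling the variable by 2 reduces this to the Gamma integral. It is the dominating
  function below; the halved decay comes from the slope \<open>D1 / 2\<close> in the tail
  bound.\<close>

lemma integrable_Gamma_half:
  assumes "0 < (b :: real)"
  shows "integrable lborel (\<lambda>t. indicator {0<..} t * (t powr (b - 1) * exp (- t / 2)))"
proof -
  have "integrable lborel (\<lambda>t. indicator {0<..} (0 + 1/2 * t) * ((0 + 1/2 * t) powr (b - 1) * exp (- (0 + 1/2 * t))))"
    using has_bochner_integral_Gamma[OF assms] by (intro lborel_integrable_real_affine) (auto simp: has_bochner_integral_iff)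
  then have "integrable lborel (\<lambda>t. 2 powr (b - 1) * (indicator {0<..} (0 + 1/2 * t) * ((0 + 1/2 * t) powr (b - 1) * exp (- (0 + 1/2 * t)))))"
    by (rule integrable_mult_right)
  also have "(\<lambda>t. 2 powr (b - 1) * (indicator {0<..} (0 + 1/2 * t) * ((0 + 1/2 * t) powr (b - 1) * exp (- (0 + 1/2 * t)))))
      = (\<lambda>t::real. indicator {0<..} t * (t powr (b - 1) * exp (- t / 2)))"
    by (auto simp: indicator_def powr_divide fun_eq_iff)
  finally show ?thesis .
qed

text \<open>Watson's lemma for the mixture: substituting \<open>l = l1 - v / (D1 * u)\<close> turns the
  integral near \<open>l1\<close> into a Gamma integral, with the tail bound as dominating function.\<close>

lemma mixture_asymptotics:
  fixes a :: "real \<Rightarrow> real \<Rightarrow> real"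
  assumes G: "prob_space G" "sets G = sets borel" "AE l in G. 0 \<le> l \<and> l < l1"
    and pos: "0 < l1" "0 < \<delta>" "0 < B" "0 < C1" "0 < D1" "0 < b" "0 < \<epsilon>"
    and meas: "\<And>u. 0 \<le> u \<Longrightarrow> a u \<in> borel_measurable borel"
    and nonneg: "\<And>u l. 0 \<le> u \<Longrightarrow> 0 \<le> l \<Longrightarrow> l < l1 \<Longrightarrow> 0 \<le> a u l"
    and bound: "\<And>u l. 0 \<le> u \<Longrightarrow> 0 \<le> l \<Longrightarrow> l < l1 \<Longrightarrow>
      a u l \<le> exp (- (R1 + D1 / 2 * min \<epsilon> (l1 - l)) * u)"
    and dens: "has_density_on G g {l1 - \<delta><..<l1}"
      "(\<lambda>z. g (l1 - z)) \<sim>[at_right 0] (\<lambda>z. B * z powr (b - 1))"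
    and lim: "\<And>v. 0 < v \<Longrightarrow>
      ((\<lambda>u. a u (l1 - v / (D1 * u)) / (C1 * exp (- R1 * u) * exp (- v))) \<longlongrightarrow> A) at_top"
  shows "((\<lambda>u. u powr b * exp (R1 * u) * (LINT l|G. a u l)) \<longlongrightarrow> A * (B * C1 * Gamma b / D1 powr b)) at_top"
proof -
  interpret G: prob_space G by fact
  note [measurable_cong] = G(2)
  let ?r = "\<lambda>z. g (l1 - z) / (B * z powr (b - 1))"
  have ratio: "(?r \<longlongrightarrow> 1) (at_right 0)"
  proof (rule Lim_transform_eventually[OF asymp_equivD[OF dens(2)]])
    show "\<forall>\<^sub>F z in at_right 0. (if g (l1 - z) = 0 \<and> B * z powr (b - 1) = 0 then 1
        else g (l1 - z) / (B * z powr (b - 1))) = ?r z"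
      using pos by (auto simp: eventually_at_right_field intro!: exI[of _ 1])
  qed
  have "\<forall>\<^sub>F z in at_right 0. ?r z < 2"
    using order_tendstoD(2)[OF ratio, of 2] by simp
  then obtain e where e: "0 < e" "\<And>z. 0 < z \<Longrightarrow> z < e \<Longrightarrow> ?r z < 2"
    by (auto simp: eventually_at_right_field)
  \<comment> \<open>Within distance \<open>d\<close> of \<open>l1\<close>: \<open>g\<close> is at
    most twice its asymptote (\<open>e\<close>), the exponent is linear (\<open>\<epsilon>\<close>),
    the density exists (\<open>\<delta>\<close>), and intensities are nonnegative
    (\<open>l1\<close>).\<close>
  define d where "d = Min {e, \<epsilon>, \<delta>, l1}"
  have d: "0 < d" "d \<le> e" "d \<le> \<epsilon>" "d \<le> \<delta>" "d \<le> l1"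
    using e pos by (auto simp: d_def)
  have gle: "g (l1 - z) \<le> 2 * (B * z powr (b - 1))" if "0 < z" "z < d" for z
  proof -
    have "0 < B * z powr (b - 1)" using pos that by simp
    then show ?thesis
      using e(2)[of z] that d by (simp add: field_simps)
  qed
  let ?S = "{l1 - d<..<l1}"
  have S: "?S \<in> sets borel" by simp
  have densS: "has_density_on G g ?S"
    using dens(1) d by (auto intro: has_density_on_subset)
  have g_nonneg: "0 \<le> g l" if "l \<in> ?S" for l
    using densS that by (auto simp: has_density_on_def)
  note gS[measurable] = has_density_on_density_eq(1)[OF densS G(2) S]
  \<comment> \<open>\<open>W\<close> cancels the expected decay. \<open>H\<close> is the normalised
    integrand after the substitution, including the Jacobian \<open>1 / (D1 * u)\<close>;
    \<open>w\<close> dominates it, with the factor 2 from \<open>gle\<close>, and \<open>f\<close>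
    is its pointwise limit.\<close>
  define W where "W u = u powr b * exp (R1 * u)" for u
  define H where "H u v = W u / (D1 * u) * (indicator ?S (l1 - v / (D1 * u)) * g (l1 - v / (D1 * u)) * a u (l1 - v / (D1 * u)))" for u v
  define w where "w v = 2 * B / D1 powr b * (indicator {0<..} v * (v powr (b - 1) * exp (- v / 2)))" for v :: real
  define f where "f v = A * (B * C1) / D1 powr b * (indicator {0<..} v * (v powr (b - 1) * exp (- v)))" for v :: real

  have H_eq: "W u * (LINT l|G. indicator ?S l * a u l) = (LINT v|lborel. H u v)" if u: "0 < u" for u
  proof -
    have "(LINT l|G. indicator ?S l * a u l) = (LINT l|lborel. indicator ?S l * g l * a u l)"
      using u by (intro integral_has_density_on[OF densS G(2) S] meas) auto
    also have "\<dots> = \<bar>- 1 / (D1 * u)\<bar> *\<^sub>R (LINT v|lborel. indicator ?S (l1 + - 1 / (D1 * u) * v) * g (l1 + - 1 / (D1 * u) * v) * a u (l1 + - 1 / (D1 * u) * v))"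
      using u pos by (intro lborel_integral_real_affine) auto
    finally show ?thesis
      using u pos by (simp add: H_def)
  qed
  have H_le: "\<bar>H u v\<bar> \<le> w v" if u: "0 < u" for u v
  proof (cases "l1 - v / (D1 * u) \<in> ?S")
    case True
    define z where "z = v / (D1 * u)"
    have v: "v = z * (D1 * u)" using u pos by (simp add: z_def)
    have z: "0 < z" "z < d" using True by (auto simp: z_def)
    have "0 < v" using z u pos by (simp add: v)
    have a: "0 \<le> a u (l1 - z)" "a u (l1 - z) \<le> exp (- (R1 * u)) * exp (- v / 2)"
    proof -
      show "0 \<le> a u (l1 - z)" using z d u by (intro nonneg) auto
      have "a u (l1 - z) \<le> exp (- (R1 + D1 / 2 * min \<epsilon> (l1 - (l1 - z))) * u)"
        using z d u by (intro bound) auto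
      also have "\<dots> = exp (- (R1 * u)) * exp (- v / 2)"
        using z d by (simp add: v min_def algebra_simps flip: exp_add)
      finally show "a u (l1 - z) \<le> exp (- (R1 * u)) * exp (- v / 2)" .
    qed
    have g: "0 \<le> g (l1 - z)" using z by (intro g_nonneg) auto
    have "\<bar>H u v\<bar> = W u / (D1 * u) * (g (l1 - z) * a u (l1 - z))"
      using True a g u pos by (simp add: H_def W_def z_def abs_mult)
    also have "\<dots> \<le> W u / (D1 * u) * (2 * (B * z powr (b - 1)) * (exp (- (R1 * u)) * exp (- v / 2)))"
      using a g u pos z gle[of z] by (intro mult_left_mono mult_mono) (auto simp: W_def)
    also have "\<dots> = 2 * B * (u powr b * z powr (b - 1) / (D1 * u)) * exp (- v / 2)"
      by (simp add: W_def exp_minus field_simps)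
    \<comment> \<open>With \<open>z = v / (D1 * u)\<close> all powers of \<open>u\<close> cancel;
      this is where the exponent \<open>b\<close> in \<open>W\<close> comes from.\<close>
    also have "u powr b * z powr (b - 1) / (D1 * u) = v powr (b - 1) / D1 powr b"
      using u pos z by (simp add: v powr_mult powr_diff field_simps)
    finally show ?thesis
      using \<open>0 < v\<close> by (simp add: w_def field_simps)
  next
    case False
    then show ?thesis using pos by (simp add: H_def w_def)
  qed
  have H_lim: "((\<lambda>u. H u v) \<longlongrightarrow> f v) at_top" for v
  proof (cases "0 < v")
    case v: True
    have to0: "filterlim (\<lambda>u. v / (D1 * u)) (at_right 0) at_top"
      using v pos by real_asymp
    have "((\<lambda>u. a u (l1 - v / (D1 * u)) / (C1 * exp (- R1 * u) * exp (- v)) * ?r (v / (D1 * u))) \<longlongrightarrow> A * 1) at_top"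
      by (intro tendsto_mult lim v filterlim_compose[OF ratio to0])
    then have "((\<lambda>u. B * C1 / D1 powr b * (v powr (b - 1) * exp (- v)) * (a u (l1 - v / (D1 * u)) / (C1 * exp (- R1 * u) * exp (- v)) * ?r (v / (D1 * u)))) \<longlongrightarrow>
        B * C1 / D1 powr b * (v powr (b - 1) * exp (- v)) * (A * 1)) at_top"
      by (rule tendsto_mult[OF tendsto_const])
    also have "B * C1 / D1 powr b * (v powr (b - 1) * exp (- v)) * (A * 1) = f v"
      using v by (simp add: f_def)
    finally show ?thesis
    proof (rule Lim_transform_eventually)
      have "\<forall>\<^sub>F u in at_top. v / (D1 * u) \<in> {0<..<d}"
        by (rule eventually_compose_filterlim[OF _ to0])
          (use d(1) in \<open>auto simp: eventually_at_right_field\<close>)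
      then show "\<forall>\<^sub>F u in at_top. B * C1 / D1 powr b * (v powr (b - 1) * exp (- v)) * (a u (l1 - v / (D1 * u)) / (C1 * exp (- R1 * u) * exp (- v)) * ?r (v / (D1 * u))) = H u v"
        using eventually_gt_at_top[of 0]
      proof eventually_elim
        case (elim u)
        define z where "z = v / (D1 * u)"
        have v': "v = z * (D1 * u)" using elim pos by (simp add: z_def)
        have "indicator ?S (l1 - z) = (1::real)" using elim by (simp add: z_def)
        then have H: "H u v = W u / (D1 * u) * (g (l1 - z) * a u (l1 - z))"
          by (simp add: H_def z_def)
        have pw: "v powr (b - 1) / D1 powr b = u powr b * z powr (b - 1) / (D1 * u)"
          using elim pos v by (simp add: v' powr_mult powr_diff field_simps)
        have z: "0 < z powr (b - 1)" using elim pos v by (simp add: z_def)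
        have "B * C1 / D1 powr b * (v powr (b - 1) * exp (- v)) *
            (a u (l1 - z) / (C1 * exp (- R1 * u) * exp (- v)) * (g (l1 - z) / (B * z powr (b - 1))))
            = (v powr (b - 1) / D1 powr b) * (exp (R1 * u) * (g (l1 - z) * a u (l1 - z))) / z powr (b - 1)"
          using pos z by (simp add: exp_minus field_simps)
        also have "\<dots> = H u v"
          unfolding pw H W_def using z by simp
        finally show ?case unfolding z_def .
      qed
    qed
  next
    case False
    have "\<forall>\<^sub>F u in at_top. f v = H u v"
      using eventually_gt_at_top[of 0]
    proof eventually_elim
      case (elim u)
      \<comment> \<open>The point \<open>l1 - v / (D1 * u)\<close> is then at least
        \<open>l1\<close>, outside \<open>?S\<close>.\<close>
      have "v / (D1 * u) \<le> 0" using False elim pos by (simp add: divide_nonpos_pos)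
      then show ?case using False by (simp add: H_def f_def)
    qed
    then show ?thesis by (rule Lim_transform_eventually[OF tendsto_const])
  qed
  have near: "((\<lambda>u. W u * (LINT l|G. indicator ?S l * a u l)) \<longlongrightarrow> A * (B * C1 * Gamma b / D1 powr b)) at_top"
  proof -
    have H_meas: "H u \<in> borel_measurable lborel" if "0 \<le> u" for u
    proof -
      let ?p = "\<lambda>v. l1 - v / (D1 * u)"
      have p: "?p \<in> lborel \<rightarrow>\<^sub>M borel" by measurable
      show ?thesis
        unfolding H_def
        by (intro borel_measurable_times[OF borel_measurable_const] borel_measurable_times
            measurable_compose[OF p gS] measurable_compose[OF p meas[OF that]])
    qed
    \<comment> \<open>Dominated convergence asks for measurability at every real parameter, but
      \<open>H u\<close> is known to be measurable only for \<open>u \<ge> 0\<close>; hence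
      \<open>max 0 u\<close>.\<close>
    have "((\<lambda>u. LINT v|lborel. H (max 0 u) v) \<longlongrightarrow> (LINT v|lborel. f v)) at_top"
    proof (rule integral_dominated_convergence_at_top[where w = w])
      show "f \<in> borel_measurable lborel" unfolding f_def by measurable
      show "integrable lborel w"
        unfolding w_def by (intro integrable_mult_right integrable_Gamma_half pos)
      show "AE v in lborel. ((\<lambda>u. H (max 0 u) v) \<longlongrightarrow> f v) at_top"
        by (intro always_eventually allI Lim_transform_eventually[OF H_lim]
            eventually_mono[OF eventually_ge_at_top[of 0]]) (simp add: max_def)
      show "\<forall>\<^sub>F u in at_top. AE v in lborel. norm (H (max 0 u) v) \<le> w v"
        using eventually_gt_at_top[of 0] by eventually_elim (simp add: H_le)
    qed (rule H_meas, simp)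
    also have "(LINT v|lborel. f v) = A * (B * C1 * Gamma b / D1 powr b)"
      using has_bochner_integral_Gamma[OF pos(6)] by (simp add: f_def has_bochner_integral_iff)
    finally show ?thesis
      by (rule Lim_transform_eventually) (use eventually_gt_at_top[of 0] in \<open>eventually_elim, simp add: H_eq\<close>)
  qed
  \<comment> \<open>At distance at least \<open>d\<close> from \<open>l1\<close>, the bound decays
    faster than \<open>exp (- R1 * u)\<close> by this additional rate, which beats the power in
    \<open>W\<close>.\<close>
  define k where "k = D1 / 2 * d"
  have k: "0 < k" using d pos by (simp add: k_def)
  have far: "((\<lambda>u. W u * (LINT l|G. indicator {..l1 - d} l * a u l)) \<longlongrightarrow> 0) at_top"
  proof (rule tendsto_sandwich[of "\<lambda>_. 0" _ _ "\<lambda>u. u powr b * exp (- k * u)"])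
    show "((\<lambda>u. u powr b * exp (- k * u)) \<longlongrightarrow> 0) at_top"
      using k pos by real_asymp
    have le: "AE l in G. 0 \<le> indicator {..l1 - d} l * a u l \<and> indicator {..l1 - d} l * a u l \<le> exp (- (R1 + k) * u)" if u: "0 \<le> u" for u
      using G(3)
    proof eventually_elim
      case (elim l)
      show ?case
      proof (cases "l \<le> l1 - d")
        case True
        have "a u l \<le> exp (- (R1 + D1 / 2 * min \<epsilon> (l1 - l)) * u)"
          using elim u by (intro bound) auto
        also have "\<dots> \<le> exp (- (R1 + k) * u)"
          unfolding k_def using True d u pos by (auto intro!: mult_right_mono)
        finally show ?thesis using True elim u nonneg by simp
      qed simp
    qed
    show "\<forall>\<^sub>F u in at_top. 0 \<le> W u * (LINT l|G. indicator {..l1 - d} l * a u l)"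
      using eventually_gt_at_top[of 0]
    proof eventually_elim
      case (elim u)
      show ?case
        using le[of u] elim by (intro mult_nonneg_nonneg integral_nonneg_AE) (auto simp: W_def)
    qed
    show "\<forall>\<^sub>F u in at_top. W u * (LINT l|G. indicator {..l1 - d} l * a u l) \<le> u powr b * exp (- k * u)"
      using eventually_gt_at_top[of 0]
    proof eventually_elim
      case (elim u)
      note [measurable] = meas[OF less_imp_le[OF elim]]
      have "(LINT l|G. indicator {..l1 - d} l * a u l) \<le> (LINT l|G. exp (- (R1 + k) * u))"
        using le[of u] elim by (intro integral_mono_AE G.integrable_const_bound[of _ "exp (- (R1 + k) * u)"]) auto
      then have "W u * (LINT l|G. indicator {..l1 - d} l * a u l) \<le> W u * exp (- (R1 + k) * u)"
        by (intro mult_left_mono) (auto simp: W_def G.prob_space)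
      also have "\<dots> = u powr b * exp (- k * u)"
        by (simp add: W_def algebra_simps flip: exp_add)
      finally show ?case .
    qed
  qed simp
  have "((\<lambda>u. W u * (LINT l|G. indicator {..l1 - d} l * a u l) + W u * (LINT l|G. indicator ?S l * a u l))
      \<longlongrightarrow> 0 + A * (B * C1 * Gamma b / D1 powr b)) at_top"
    by (intro tendsto_add far near)
  then have "((\<lambda>u. W u * (LINT l|G. a u l)) \<longlongrightarrow> 0 + A * (B * C1 * Gamma b / D1 powr b)) at_top"
  proof (rule Lim_transform_eventually)
    show "\<forall>\<^sub>F u in at_top. W u * (LINT l|G. indicator {..l1 - d} l * a u l) + W u * (LINT l|G. indicator ?S l * a u l)
        = W u * (LINT l|G. a u l)"
      using eventually_ge_at_top[of 0]
    proof eventually_elim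
      case (elim u)
      note [measurable] = meas[OF elim]
      have le: "AE l in G. \<bar>a u l\<bar> \<le> exp (- R1 * u)"
        using G(3)
      proof eventually_elim
        case (elim l)
        have "a u l \<le> exp (- (R1 + D1 / 2 * min \<epsilon> (l1 - l)) * u)"
          using elim \<open>0 \<le> u\<close> by (intro bound) auto
        also have "\<dots> \<le> exp (- R1 * u)"
          using elim \<open>0 \<le> u\<close> pos by (simp only: exp_le_cancel_iff) (intro mult_right_mono; simp)
        finally show ?case using elim \<open>0 \<le> u\<close> nonneg by simp
      qed
      have int: "integrable G (\<lambda>l. indicator V l * a u l)" if [measurable]: "V \<in> sets borel" for V
        using le by (intro G.integrable_const_bound[of _ "exp (- R1 * u)"]) (auto elim!: eventually_mono simp: indicator_def)
      have "(LINT l|G. indicator {..l1 - d} l * a u l) + (LINT l|G. indicator ?S l * a u l)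
          = (LINT l|G. indicator {..l1 - d} l * a u l + indicator ?S l * a u l)"
        by (intro Bochner_Integration.integral_add[symmetric] int) auto
      also have "\<dots> = (LINT l|G. a u l)"
      proof (rule integral_cong_AE)
        show "AE l in G. indicator {..l1 - d} l * a u l + indicator ?S l * a u l = a u l"
          using G(3) by eventually_elim (auto simp: indicator_def)
      qed measurable
      finally show ?case by (simp flip: distrib_left)
    qed
  qed
  then show ?thesis by (simp add: W_def)
qed

section \<open>The mixed Poisson model\<close>

text \<open>Strict convexity of \<open>exp\<close>. For solutions \<open>r < s\<close> and
  \<open>\<theta> = r / s\<close>, the gap
  \<open>\<theta> * exp (s * x) + (1 - \<theta>) - exp (r * x)\<close> is positive for
  \<open>x > 0\<close>, yet the two Lundberg equations make its expectation 0. This gives meaning to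
  the \<open>THE\<close> in \<open>adjustment_coeff\<close>.\<close>

lemma is_adjustment_coeff_unique:
  assumes pos: "AE x in F. 0 < x" and F: "prob_space F"
    and r: "is_adjustment_coeff c F l r1" "is_adjustment_coeff c F l r2"
  shows "r1 = r2"
proof -
  interpret F: prob_space F by fact
  have False if r: "is_adjustment_coeff c F l r" "is_adjustment_coeff c F l s" and "r < s" for r s
  proof -
    define \<theta> where "\<theta> = r / s"
    have rs: "0 < r" "0 < s" "0 < l" and int: "integrable F (\<lambda>x. exp (r * x))" "integrable F (\<lambda>x. exp (s * x))"
      and eq: "l * ((LINT x|F. exp (r * x)) - 1) = c * r" "l * ((LINT x|F. exp (s * x)) - 1) = c * s"
      using r by (auto simp: is_adjustment_coeff_def)
    have \<theta>: "0 < \<theta>" "\<theta> < 1" "r = \<theta> * s"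
      using rs \<open>r < s\<close> by (auto simp: \<theta>_def)
    let ?d = "\<lambda>x. \<theta> * exp (s * x) + (1 - \<theta>) - exp (r * x)"
    have d_pos: "0 < ?d x" if "0 < x" for x
    proof -
      define y where "y = s * x"
      have y: "0 < y" using rs that by (simp add: y_def)
      have strict: "1 + z < exp z" if "0 < z" for z :: real
        using exp_lower_Taylor_quadratic[of z] that by (smt (verit) divide_pos_pos zero_less_power)
      \<comment> \<open>The tangent of \<open>exp\<close> at \<open>\<theta> * y\<close> is compared
        with \<open>exp\<close> at \<open>y\<close> (strictly) and at 0. With weights
        \<open>\<theta>\<close> and \<open>1 - \<theta>\<close> the linear terms cancel.\<close>
      have "exp (\<theta> * y) * (1 + (1 - \<theta>) * y) < exp (\<theta> * y) * exp ((1 - \<theta>) * y)"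
        using \<theta> y by (intro mult_strict_left_mono strict) auto
      also have "\<dots> = exp y" by (simp add: algebra_simps flip: exp_add)
      finally have "\<theta> * (exp (\<theta> * y) * (1 + (1 - \<theta>) * y)) < \<theta> * exp y"
        using \<theta> by simp
      moreover have "exp (\<theta> * y) * (1 - \<theta> * y) \<le> exp (\<theta> * y) * exp (- (\<theta> * y))"
        using exp_ge_add_one_self[of "- (\<theta> * y)"] by (intro mult_left_mono) auto
      then have "(1 - \<theta>) * (exp (\<theta> * y) * (1 - \<theta> * y)) \<le> 1 - \<theta>"
        using \<theta> by (simp add: exp_minus mult_left_le)
      moreover have "\<theta> * (exp (\<theta> * y) * (1 + (1 - \<theta>) * y)) + (1 - \<theta>) * (exp (\<theta> * y) * (1 - \<theta> * y)) = exp (\<theta> * y)"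
        by (simp add: algebra_simps)
      ultimately have "exp (\<theta> * y) < \<theta> * exp y + (1 - \<theta>)"
        by linarith
      then show ?thesis
        using \<theta>(3) by (simp add: y_def mult.assoc)
    qed
    have "(LINT x|F. ?d x) = \<theta> * (LINT x|F. exp (s * x)) + (1 - \<theta>) - (LINT x|F. exp (r * x))"
      using int by (simp add: F.prob_space)
    also have "\<dots> = 0"
    proof -
      have "l * (\<theta> * (LINT x|F. exp (s * x)) + (1 - \<theta>) - (LINT x|F. exp (r * x)))
          = \<theta> * (l * ((LINT x|F. exp (s * x)) - 1)) - l * ((LINT x|F. exp (r * x)) - 1)"
        by (simp add: algebra_simps)
      also have "\<dots> = 0"
        unfolding eq using \<theta>(3) by simp
      finally show ?thesis using rs by simp
    qed
    finally have "AE x in F. ?d x = 0"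
      using int pos d_pos
      by (subst (asm) integral_nonneg_eq_0_iff_AE) (auto elim!: eventually_mono intro: less_imp_le)
    with pos have "AE x in F. False"
      by eventually_elim (use d_pos in force)
    then show False by simp
  qed
  then show ?thesis
    using r by (metis linorder_neqE_linordered_idom)
qed

text \<open>In \<open>ereal\<close> the supremum bounds each member without a boundedness
  condition.\<close>

lemma tendsto_of_ereal_SUP:
  fixes f :: "real \<Rightarrow> 'a \<Rightarrow> real"
  assumes lim: "((\<lambda>u. SUP v\<in>V. ereal \<bar>f u v\<bar>) \<longlongrightarrow> 0) F" and v: "v \<in> V"
  shows "((\<lambda>u. f u v) \<longlongrightarrow> 0) F"
proof -
  have "((\<lambda>u. ereal \<bar>f u v\<bar>) \<longlongrightarrow> 0) F"
  proof (rule tendsto_sandwich[OF _ _ tendsto_const lim])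
    show "\<forall>\<^sub>F u in F. 0 \<le> ereal \<bar>f u v\<bar>"
      by simp
    show "\<forall>\<^sub>F u in F. ereal \<bar>f u v\<bar> \<le> (SUP v\<in>V. ereal \<bar>f u v\<bar>)"
      using v by (intro always_eventually allI SUP_upper)
  qed
  then have "((\<lambda>u. \<bar>f u v\<bar>) \<longlongrightarrow> 0) F"
    unfolding zero_ereal_def by simp
  then show ?thesis
    by (rule tendsto_rabs_zero_cancel)
qed

context mixed_poisson_cramer_lundberg
begin

lemma sets_K: "sets (K l) = sets P"
  using measurable_space[OF kernel, of l] by (simp add: space_prob_algebra)

lemma space_K: "space (K l) = space P"
  by (rule sets_eq_imp_space_eq[OF sets_K])

lemma prob_space_K: "prob_space (K l)"
  using measurable_space[OF kernel, of l] by (simp add: space_prob_algebra)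

lemma sets_G: "sets G = sets borel"
  using Lam_distr by auto

lemma prob_space_G: "prob_space G"
  using prob_space_distr[OF Lam_measurable] Lam_distr by simp

text \<open>Path regularity belongs to the conditional models. All \<open>K l\<close> share the
  space of \<open>P\<close>, so the model at \<open>l = 0\<close> supplies it for every
  outcome.\<close>

lemma risk_pathI: "0 \<le> u \<Longrightarrow> w \<in> space P \<Longrightarrow> risk_path c u N w"
  using cramer_lundberg.risk_pathI[OF conditional_model[of 0] premium_pos] by (simp add: space_K)

lemma ruin_event_pred: "0 \<le> u \<Longrightarrow> Measurable.pred P (\<lambda>w. ruin_time c N X u w < \<infinity>)"
  using cramer_lundberg.ruin_event_pred[OF conditional_model[of 0] premium_pos]
  by (simp only: measurable_cong_sets[OF sets_K refl] order_refl)

lemma deficit_measurable: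
  "0 \<le> u \<Longrightarrow> (\<lambda>w. if ruin_time c N X u w < \<infinity> then deficit c N X u w else 0) \<in> borel_measurable P"
  using cramer_lundberg.deficit_measurable[OF conditional_model[of 0] premium_pos]
  by (simp only: measurable_cong_sets[OF sets_K refl] order_refl)

lemma emeasure_mixture: "A \<in> sets P \<Longrightarrow> emeasure P A = (\<integral>\<^sup>+l. emeasure (K l) A \<partial>G)"
  using conditional[of A UNIV] by simp

lemma kernel_G: "K \<in> G \<rightarrow>\<^sub>M subprob_algebra P"
  using measurable_prob_algebraD[OF kernel] by (simp only: measurable_cong_sets[OF sets_G refl])

lemma mixture: "P = G \<bind> K"
proof (rule measure_eqI)
  have G: "space G \<noteq> {}" using prob_space.not_empty[OF prob_space_G] .
  show sets: "sets P = sets (G \<bind> K)"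
    using G by (subst sets_bind[OF sets_K]) auto
  show "emeasure P A = emeasure (G \<bind> K) A" if "A \<in> sets P" for A
    by (simp add: emeasure_bind[OF G kernel_G that] emeasure_mixture[OF that])
qed

lemma integral_kernel_measurable:
  fixes h :: "'w \<Rightarrow> real"
  assumes "h \<in> borel_measurable P"
  shows "(\<lambda>l. LINT w|K l. h w) \<in> borel_measurable borel"
  using measurable_compose[OF measurable_prob_algebraD[OF kernel] integral_measurable_subprob_algebra[OF assms]] .

lemma integral_mixture:
  fixes h :: "'w \<Rightarrow> real"
  assumes h: "h \<in> borel_measurable P" "\<And>w. 0 \<le> h w" "\<And>w. h w \<le> 1"
  shows "(LINT w|P. h w) = (LINT l|G. LINT w|K l. h w)"
proof -
  have hK: "h \<in> borel_measurable (K l)" for l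
    using h(1) by (simp only: measurable_cong_sets[OF sets_K refl])
  have "(\<integral>\<^sup>+w. ennreal (h w) \<partial>P) = (\<integral>\<^sup>+l. \<integral>\<^sup>+w. ennreal (h w) \<partial>K l \<partial>G)"
    by (subst mixture, rule nn_integral_bind[OF _ kernel_G]) (use h(1) in measurable)
  also have "\<dots> = (\<integral>\<^sup>+l. ennreal (LINT w|K l. h w) \<partial>G)"
  proof (intro nn_integral_cong nn_integral_eq_integral AE_I2 h(2))
    fix l
    interpret Kl: prob_space "K l" by (rule prob_space_K)
    show "integrable (K l) h"
      by (rule Kl.integrable_const_bound[of _ 1]) (use h hK in auto)
  qed
  finally have eq: "(\<integral>\<^sup>+w. ennreal (h w) \<partial>P) = (\<integral>\<^sup>+l. ennreal (LINT w|K l. h w) \<partial>G)" .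
  have "(LINT w|P. h w) = enn2real (\<integral>\<^sup>+w. ennreal (h w) \<partial>P)"
    using h by (intro integral_eq_nn_integral) auto
  also have "\<dots> = (LINT l|G. LINT w|K l. h w)"
    unfolding eq using h integral_kernel_measurable[OF h(1)]
    by (intro integral_eq_nn_integral[symmetric]) (auto cong: measurable_cong_sets simp: sets_G intro!: integral_nonneg)
  finally show ?thesis .
qed

text \<open>On the ruin event the deficit is negative, so it falls into the domain of integration;
  the integral can then be taken over \<open>Q\<close> itself, the form needed for mixing over
  \<open>l\<close>.\<close>

lemma ruin_law_integral:
  fixes \<psi> :: "real \<Rightarrow> real"
  assumes Q: "sets Q = sets P" and u: "0 \<le> u" and \<psi>: "\<psi> \<in> borel_measurable borel"
  shows "(LINT y:{..<0}|ruin_law c N X Q u. \<psi> y) =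
    (LINT w|Q. (if ruin_time c N X u w < \<infinity> then \<psi> (deficit c N X u w) else 0))"
proof -
  note spQ = sets_eq_imp_space_eq[OF Q]
  let ?E = "{w \<in> space Q. ruin_time c N X u w < \<infinity>}"
  have E: "?E \<in> sets Q"
    using ruin_event_pred[OF u] by (simp add: Q spQ pred_def)
  have D: "deficit c N X u \<in> restrict_space Q ?E \<rightarrow>\<^sub>M borel"
  proof -
    have "(\<lambda>w. if ruin_time c N X u w < \<infinity> then deficit c N X u w else 0) \<in> borel_measurable Q"
      using deficit_measurable[OF u] by (simp only: measurable_cong_sets[OF Q refl])
    then have "(\<lambda>w. if ruin_time c N X u w < \<infinity> then deficit c N X u w else 0) \<in> borel_measurable (restrict_space Q ?E)"
      by (rule measurable_restrict_space1)
    then show ?thesis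
      by (rule measurable_cong[THEN iffD1, rotated]) (simp add: space_restrict_space)
  qed
  have "(LINT y:{..<0}|ruin_law c N X Q u. \<psi> y)
      = (LINT w|restrict_space Q ?E. indicator {..<0} (deficit c N X u w) *\<^sub>R \<psi> (deficit c N X u w))"
    unfolding ruin_law_def set_lebesgue_integral_def deficit_def[symmetric]
    by (rule integral_distr[OF D]) (use \<psi> in measurable)
  also have "\<dots> = (LINT w|Q. indicator ?E w *\<^sub>R (indicator {..<0} (deficit c N X u w) *\<^sub>R \<psi> (deficit c N X u w)))"
    using E by (intro integral_restrict_space) simp
  also have "\<dots> = (LINT w|Q. (if ruin_time c N X u w < \<infinity> then \<psi> (deficit c N X u w) else 0))"
  proof (intro Bochner_Integration.integral_cong refl)
    fix w assume w: "w \<in> space Q"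
    show "indicator ?E w *\<^sub>R (indicator {..<0} (deficit c N X u w) *\<^sub>R \<psi> (deficit c N X u w))
        = (if ruin_time c N X u w < \<infinity> then \<psi> (deficit c N X u w) else 0)"
      using risk_path.deficit_neg[OF risk_pathI[OF u]] w spQ by auto
  qed
  finally show ?thesis .
qed

text \<open>Since \<open>l'\<close> times the exponential moment minus 1 equals
  \<open>c * r > 0\<close>, that difference is positive, and lowering the intensity keeps the
  Lundberg inequality for the same \<open>r\<close>.\<close>

lemma ruin_prob_le:
  assumes "is_adjustment_coeff c F l' r" "0 \<le> l" "l \<le> l'" "0 \<le> u"
  shows "measure (K l) {w \<in> space (K l). ruin_time c N X u w < \<infinity>} \<le> exp (- r * u)"
proof -
  interpret Kl: cramer_lundberg "K l" N l X F
    using assms by (intro conditional_model)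
  have r: "0 < l'" "0 < r" "integrable F (\<lambda>x. exp (r * x))" "l' * ((LINT x|F. exp (r * x)) - 1) = c * r"
    using assms(1) by (auto simp: is_adjustment_coeff_def)
  have "0 \<le> (LINT x|F. exp (r * x)) - 1"
    using r premium_pos by (metis mult_pos_pos less_imp_le zero_less_mult_pos)
  then have "l * ((LINT x|F. exp (r * x)) - 1) \<le> l' * ((LINT x|F. exp (r * x)) - 1)"
    using assms by (intro mult_right_mono)
  then show ?thesis
    using r premium_pos assms by (intro Kl.lundberg_inequality) auto
qed

lemma adjustment_coeff_eq:
  "is_adjustment_coeff c F l r \<Longrightarrow> adjustment_coeff c F l = r"
  unfolding adjustment_coeff_def
  using is_adjustment_coeff_unique[OF claim_pos claim.prob_space_axioms] by (intro the_equality) auto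

text \<open>By definition of the infimum \<open>cdf G\<close> is 1 to the right of
  \<open>l1\<close>; right continuity gives the value 1 at \<open>l1\<close> as well, and the
  missing atom makes the bound strict.\<close>

lemma AE_G_bounds:
  assumes "max_rate G = ereal l1" "measure G {l1} = 0"
  shows "AE l in G. 0 \<le> l \<and> l < l1"
proof -
  interpret G: prob_space G by (rule prob_space_G)
  note [measurable_cong] = sets_G
  interpret Gr: real_distribution G
    using sets_G by unfold_locales (simp_all add: sets_eq_imp_space_eq)
  have "AE l in distr P borel Lam. 0 \<le> l"
    using Lam_nonneg Lam_measurable by (subst AE_distr_iff) auto
  then have nonneg: "AE l in G. 0 \<le> l" unfolding Lam_distr .
  have "cdf G l = 1" if l: "l1 < l" for l
  proof -
    have "(INF l\<in>{l. 0 \<le> l \<and> cdf G l = 1}. ereal l) < ereal l"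
      using assms(1) l by (simp add: max_rate_def)
    then obtain k where "k < l" "cdf G k = 1"
      unfolding INF_less_iff by auto
    then show ?thesis
      using Gr.cdf_nondecreasing[of k l] Gr.cdf_bounded_prob[of l] by simp
  qed
  then have "\<forall>\<^sub>F l in at_right l1. cdf G l = 1"
    by (auto simp: eventually_at_right_field intro!: exI[of _ "l1 + 1"])
  then have "(cdf G \<longlongrightarrow> 1) (at_right l1)"
    by (rule Lim_transform_eventually[OF tendsto_const, OF eventually_mono]) simp
  moreover have "(cdf G \<longlongrightarrow> cdf G l1) (at_right l1)"
    using Gr.cdf_is_right_cont[of l1] by (simp add: continuous_within)
  ultimately have "cdf G l1 = 1"
    by (intro tendsto_unique[of "at_right l1"]) auto
  then have "AE l in G. l \<in> {..l1}"
    by (intro G.AE_prob_1) (simp add: cdf_def)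
  moreover have "AE l in G. l \<notin> {l1}"
    using assms(2) by (intro AE_not_in) (auto simp: null_sets_def G.emeasure_eq_measure)
  ultimately show ?thesis
    using nonneg by eventually_elim auto
qed

end

theorem theorem4p3:
  fixes P :: "'w measure" and F G :: "real measure" and K :: "real \<Rightarrow> 'w measure"
    and Lam :: "'w \<Rightarrow> real" and c :: real
    and N :: "real \<Rightarrow> 'w \<Rightarrow> nat" and X :: "nat \<Rightarrow> 'w \<Rightarrow> real"
    and \<psi> g :: "real \<Rightarrow> real"
    and l1 \<delta> B C1 D1 R1 b \<eta> c_l1 R_l1 C_l1 :: real
  assumes model: "mixed_poisson_cramer_lundberg P F K Lam G c N X"
    and psi: "modified_ruin_probability P c N X \<psi>"
    and l1: "max_rate G = ereal l1" "0 < l1" "l1 < c / claim_mean F" "measure G {l1} = 0"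
    and constants: "0 < \<delta>" "0 < B" "0 < C1" "0 < D1" "0 < R1" "0 < b"
    and dens: "has_density_on G g {l1 - \<delta><..<l1}"
      "(\<lambda>z. g (l1 - z)) \<sim>[at_right 0] (\<lambda>z. B * z powr (b - 1))"
    and constants_l1: "0 < c_l1" "0 < R_l1"
    and C_l1: "C_l1 = (LINT y:{..<0}|limit_deficit_law c F l1 R_l1. \<psi> y)"
    and cl_l1: "(\<lambda>u. psi_cl_at F K c N X u l1) \<sim>[at_top] (\<lambda>u. c_l1 * exp (- R_l1 * u))"
    and psi_l1: "(\<lambda>u. psi_at K c N X \<psi> u l1) \<sim>[at_top] (\<lambda>u. C_l1 * psi_cl_at F K c N X u l1)"
    and cl_unif: "\<And>M. 0 < M \<Longrightarrow>
      ((\<lambda>u. SUP v\<in>{0..M}. ereal \<bar>psi_cl_at F K c N X u (l1 - v / (D1 * u))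
              / (C1 * exp (- R1 * u) * exp (- v)) - 1\<bar>) \<longlongrightarrow> 0) at_top"
    and psi_unif: "\<And>M. 0 < M \<Longrightarrow>
      ((\<lambda>u. SUP v\<in>{0..M}. ereal \<bar>psi_at K c N X \<psi> u (l1 - v / (D1 * u))
              / psi_cl_at F K c N X u (l1 - v / (D1 * u)) - C_l1\<bar>) \<longlongrightarrow> 0) at_top"
    and adj_ex: "\<And>l. l1 - \<delta> < l \<Longrightarrow> l \<le> l1 \<Longrightarrow> \<exists>r. is_adjustment_coeff c F l r"
    and adj_l1: "adjustment_coeff c F l1 = R1"
      "(adjustment_coeff c F has_real_derivative - D1) (at_left l1)"
    and eta: "0 < \<eta>"
    and adj_gap: "\<And>l. 0 < l \<Longrightarrow> l \<le> l1 - \<delta> \<Longrightarrow>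
      (\<exists>r. is_adjustment_coeff c F l r) \<and> R1 + \<eta> \<le> adjustment_coeff c F l"
    and regular: "continuous_on {..<0} \<psi> \<or> mono_on {..<0} \<psi> \<or> antimono_on {..<0} \<psi>"
  shows "\<psi> \<sim>[at_top] (\<lambda>u. C_l1 * psi_cl F K G c N X u)
    \<and> (\<lambda>u. C_l1 * psi_cl F K G c N X u) \<sim>[at_top]
        (\<lambda>u. C_l1 * (B * C1 * Gamma b / (D1 * u) powr b) * exp (- R1 * u))"
proof -
  interpret mixed_poisson_cramer_lundberg P F K Lam G c N X by (rule model)
  let ?E = "\<lambda>u. {w \<in> space P. ruin_time c N X u w < \<infinity>}"
  let ?h = "\<lambda>u w. if ruin_time c N X u w < \<infinity> then \<psi> (deficit c N X u w) else 0"
  \<comment> \<open>\<open>p\<close> is the bare conditional ruin probability; it agrees with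
    \<open>psi_cl_at\<close> for \<open>l < l1\<close>, where the convention for large intensities
    does not apply. \<open>q\<close> is \<open>psi_at\<close> as an integral over outcomes.\<close>
  define p where "p u l = measure (K l) (?E u)" for u l
  define q where "q u l = (LINT w|K l. ?h u w)" for u l
  define W where "W u = u powr b * exp (R1 * u)" for u
  define \<kappa> where "\<kappa> = B * C1 * Gamma b / D1 powr b"
  have \<kappa>: "0 < \<kappa>"
    using constants by (simp add: \<kappa>_def Gamma_real_pos)
  \<comment> \<open>A mean of at most 0 would make \<open>c / claim_mean F\<close> at most 0
    (division by 0 gives 0), contradicting \<open>0 < l1 < c / claim_mean F\<close>.\<close>
  have mean: "0 < claim_mean F"
    using l1(2,3) premium_pos by (smt (verit) divide_nonneg_nonpos)
  have \<psi>: "\<psi> \<in> borel_measurable borel" "\<And>y. 0 \<le> \<psi> y" "\<And>y. \<psi> y \<le> 1"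
    and \<psi>_eq: "\<And>u. 0 \<le> u \<Longrightarrow> \<psi> u = (LINT y:{..<0}|ruin_law c N X P u. \<psi> y)"
    using psi by (auto simp: modified_ruin_probability_def)
  note AE_G = AE_G_bounds[OF l1(1,4)]

  have E: "?E u \<in> sets P" if "0 \<le> u" for u
    using ruin_event_pred[OF that] by (simp add: pred_def)
  have h_meas: "?h u \<in> borel_measurable P" if "0 \<le> u" for u
  proof -
    note [measurable] = ruin_event_pred[OF that] deficit_measurable[OF that] \<psi>(1)
    have "?h u = (\<lambda>w. if ruin_time c N X u w < \<infinity>
        then \<psi> (if ruin_time c N X u w < \<infinity> then deficit c N X u w else 0) else 0)"
      by auto
    then show ?thesis by (simp only:) measurable
  qed
  have h_meas_K: "?h u \<in> borel_measurable (K l)" if "0 \<le> u" for u l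
    using h_meas[OF that] by (simp only: measurable_cong_sets[OF sets_K refl])
  have h_int: "integrable (K l) (?h u)" if "0 \<le> u" for u l
  proof -
    interpret Kl: prob_space "K l" by (rule prob_space_K)
    show ?thesis
      by (rule Kl.integrable_const_bound[of _ 1]) (use h_meas_K[OF that] \<psi> in auto)
  qed

  have psi_at_eq: "psi_at K c N X \<psi> u l = q u l" if "0 \<le> u" for u l
    unfolding psi_at_def q_def by (rule ruin_law_integral[OF sets_K that \<psi>(1)])
  have \<psi>_mix: "\<psi> u = (LINT l|G. q u l)" if u: "0 \<le> u" for u
  proof -
    have "\<psi> u = (LINT w|P. ?h u w)"
      unfolding \<psi>_eq[OF u] by (rule ruin_law_integral[OF refl u \<psi>(1)])
    also have "\<dots> = (LINT l|G. q u l)"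
      unfolding q_def by (rule integral_mixture[OF h_meas[OF u]]) (use \<psi> in auto)
    finally show ?thesis .
  qed
  have psi_cl_at_eq: "psi_cl_at F K c N X u l = p u l" if "l < l1" for u l
  proof -
    have "l * claim_mean F < l1 * claim_mean F"
      using that mean by simp
    also have "\<dots> < c"
      using l1(3) mean by (simp add: pos_less_divide_eq)
    finally show ?thesis by (simp add: psi_cl_at_def p_def space_K)
  qed
  have p_meas: "p u \<in> borel_measurable borel" if "0 \<le> u" for u
    unfolding p_def
    by (rule measurable_compose[OF kernel measurable_measure_prob_algebra[OF E[OF that]]])
  have q_meas: "q u \<in> borel_measurable borel" if "0 \<le> u" for u
    unfolding q_def by (rule integral_kernel_measurable[OF h_meas[OF that]])
  have psi_cl_eq: "psi_cl F K G c N X u = (LINT l|G. p u l)" if u: "0 \<le> u" for u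
    unfolding psi_cl_def set_lebesgue_integral_def
  proof (rule integral_cong_AE)
    note [measurable] = p_meas[OF u]
    note [measurable_cong] = sets_G
    show "p u \<in> borel_measurable G" by measurable
    have "psi_cl_at F K c N X u \<in> borel_measurable borel"
    proof -
      have "psi_cl_at F K c N X u = (\<lambda>l. if c \<le> l * claim_mean F then 1 else p u l)"
        by (simp add: psi_cl_at_def p_def space_K fun_eq_iff)
      then show ?thesis by (simp only:) measurable
    qed
    then show "(\<lambda>l. indicator {0..} l *\<^sub>R psi_cl_at F K c N X u l) \<in> borel_measurable G"
      by measurable
    show "AE l in G. indicator {0..} l *\<^sub>R psi_cl_at F K c N X u l = p u l"
      using AE_G by eventually_elim (simp add: psi_cl_at_eq)
  qed
  have p_nonneg: "0 \<le> p u l" for u l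
    by (simp add: p_def)
  have q_nonneg: "0 \<le> q u l" for u l
    unfolding q_def by (intro Bochner_Integration.integral_nonneg) (simp add: \<psi>)
  have q_le_p: "q u l \<le> p u l" if "0 \<le> u" for u l
  proof -
    interpret Kl: prob_space "K l" by (rule prob_space_K)
    have EK: "?E u \<in> sets (K l)" using E[OF that] by (simp add: sets_K)
    have "q u l \<le> (LINT w|K l. indicator (?E u) w)"
      unfolding q_def
    proof (rule integral_mono[OF h_int[OF that]])
      show "integrable (K l) (indicator (?E u) :: 'w \<Rightarrow> real)"
        using EK by (intro Kl.integrable_const_bound[of _ 1]) auto
    qed (use \<psi> in \<open>auto simp: space_K\<close>)
    then show ?thesis using EK by (simp add: p_def)
  qed

  \<comment> \<open>Exponential bound uniform in the intensity\<close>
  obtain \<epsilon> where \<epsilon>: "0 < \<epsilon>" and p_le: "\<And>u l. 0 \<le> u \<Longrightarrow> 0 \<le> l \<Longrightarrow> l < l1 \<Longrightarrow>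
      p u l \<le> exp (- (R1 + D1 / 2 * min \<epsilon> (l1 - l)) * u)"
  proof -
    let ?R = "adjustment_coeff c F"
    have "((\<lambda>l. (?R l - ?R l1) / (l - l1)) \<longlongrightarrow> - D1) (at_left l1)"
      using adj_l1(2) by (simp add: has_field_derivative_iff)
    \<comment> \<open>The quotients tend to \<open>- D1\<close>, which lies strictly below
      \<open>- D1 / 2\<close>.\<close>
    then have "\<forall>\<^sub>F l in at_left l1. (?R l - ?R l1) / (l - l1) < - D1 / 2"
      using constants by (intro order_tendstoD(2)) auto
    then obtain a where a: "a < l1" "\<And>l. a < l \<Longrightarrow> l < l1 \<Longrightarrow> (?R l - ?R l1) / (l - l1) < - D1 / 2"
      by (auto simp: eventually_at_left_field)
    define \<epsilon> where "\<epsilon> = min (l1 - a) \<delta> / 2"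
    have \<epsilon>: "0 < \<epsilon>" "\<epsilon> < l1 - a" "\<epsilon> < \<delta>"
      using a constants by (auto simp: \<epsilon>_def)
    have "p u l \<le> exp (- (R1 + D1 / 2 * min \<epsilon> (l1 - l)) * u)" if u: "0 \<le> u" and l: "0 \<le> l" "l < l1" for u l
    proof -
      \<comment> \<open>Near \<open>l1\<close> the intensity uses its own adjustment coefficient,
        farther away the one at \<open>l1 - \<epsilon>\<close>. So the coefficient is always taken
        where the difference quotient is controlled, which produces the minimum in the
        exponent.\<close>
      define l' where "l' = max l (l1 - \<epsilon>)"
      have l': "l \<le> l'" "a < l'" "l1 - \<delta> < l'" "l' < l1" "l1 - l' = min \<epsilon> (l1 - l)"
        using l \<epsilon> by (auto simp: l'_def)
      obtain r where r: "is_adjustment_coeff c F l' r"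
        using adj_ex[of l'] l' by auto
      have "(?R l' - ?R l1) / (l' - l1) < - D1 / 2"
        using a(2) l' by simp
      then have "R1 + D1 / 2 * (l1 - l') \<le> r"
        unfolding adjustment_coeff_eq[OF r] adj_l1(1) using l'(4) by (simp add: neg_divide_less_eq field_simps)
      then have "(R1 + D1 / 2 * min \<epsilon> (l1 - l)) * u \<le> r * u"
        using u unfolding l'(5) by (rule mult_right_mono)
      moreover have "p u l \<le> exp (- r * u)"
        using ruin_prob_le[OF r l(1) l'(1) u] by (simp add: p_def space_K)
      ultimately show ?thesis
        by (smt (verit) exp_le_cancel_iff mult_minus_left)
    qed
    with \<epsilon>(1) show thesis by (rule that)
  qed

  \<comment> \<open>Limits at the substituted intensity\<close>
  have below: "l1 - v / (D1 * u) < l1" if "0 < v" "0 < u" for u v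
    using that constants by simp
  have p_lim: "((\<lambda>u. p u (l1 - v / (D1 * u)) / (C1 * exp (- R1 * u) * exp (- v))) \<longlongrightarrow> 1) at_top" if v: "0 < v" for v
  proof -
    have "((\<lambda>u. psi_cl_at F K c N X u (l1 - v / (D1 * u)) / (C1 * exp (- R1 * u) * exp (- v)) - 1) \<longlongrightarrow> 0) at_top"
      by (rule tendsto_of_ereal_SUP[OF cl_unif[OF v], where v = v]) (use v in auto)
    then have "((\<lambda>u. psi_cl_at F K c N X u (l1 - v / (D1 * u)) / (C1 * exp (- R1 * u) * exp (- v))) \<longlongrightarrow> 1) at_top"
      by (simp add: LIM_zero_iff)
    then show ?thesis
      by (rule Lim_transform_eventually)
        (use eventually_gt_at_top[of 0] in \<open>eventually_elim, simp add: psi_cl_at_eq below v\<close>)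
  qed
  have q_lim: "((\<lambda>u. q u (l1 - v / (D1 * u)) / (C1 * exp (- R1 * u) * exp (- v))) \<longlongrightarrow> C_l1) at_top" if v: "0 < v" for v
  proof -
    let ?l = "\<lambda>u. l1 - v / (D1 * u)" and ?e = "\<lambda>u. C1 * exp (- R1 * u) * exp (- v)"
    have "((\<lambda>u. psi_at K c N X \<psi> u (?l u) / psi_cl_at F K c N X u (?l u) - C_l1) \<longlongrightarrow> 0) at_top"
      by (rule tendsto_of_ereal_SUP[OF psi_unif[OF v], where v = v]) (use v in auto)
    then have "((\<lambda>u. psi_at K c N X \<psi> u (?l u) / psi_cl_at F K c N X u (?l u)) \<longlongrightarrow> C_l1) at_top"
      by (simp add: LIM_zero_iff)
    from tendsto_mult[OF this p_lim[OF v]]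
    have "((\<lambda>u. psi_at K c N X \<psi> u (?l u) / psi_cl_at F K c N X u (?l u) * (p u (?l u) / ?e u)) \<longlongrightarrow> C_l1) at_top"
      by simp
    then show ?thesis
    proof (rule Lim_transform_eventually)
      \<comment> \<open>The ratio tends to 1, so \<open>p\<close> is eventually nonzero and cancels
        in the product of quotients.\<close>
      have "\<forall>\<^sub>F u in at_top. p u (?l u) / ?e u \<noteq> 0"
        using order_tendstoD(1)[OF p_lim[OF v], of 0] by (auto elim: eventually_mono)
      then show "\<forall>\<^sub>F u in at_top. psi_at K c N X \<psi> u (?l u) / psi_cl_at F K c N X u (?l u) * (p u (?l u) / ?e u) = q u (?l u) / ?e u"
        using eventually_gt_at_top[of 0]
      proof eventually_elim
        case (elim u)
        then show ?case
          using psi_at_eq[of u "?l u"] psi_cl_at_eq[OF below[OF v], of u u] by auto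
      qed
    qed
  qed

  have cl_asymp: "((\<lambda>u. W u * (LINT l|G. p u l)) \<longlongrightarrow> \<kappa>) at_top"
    unfolding W_def \<kappa>_def
    using mixture_asymptotics[OF prob_space_G sets_G AE_G l1(2) constants(1-4) constants(6) \<epsilon> p_meas p_nonneg p_le dens p_lim]
    by simp
  have \<psi>_asymp: "((\<lambda>u. W u * (LINT l|G. q u l)) \<longlongrightarrow> C_l1 * \<kappa>) at_top"
    unfolding W_def \<kappa>_def
  proof (rule mixture_asymptotics[OF prob_space_G sets_G AE_G l1(2) constants(1-4) constants(6) \<epsilon> q_meas q_nonneg _ dens q_lim])
    fix u l :: real assume "0 \<le> u" "0 \<le> l" "l < l1"
    then show "q u l \<le> exp (- (R1 + D1 / 2 * min \<epsilon> (l1 - l)) * u)"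
      by (intro order_trans[OF q_le_p p_le])
  qed
  have W_pos: "0 < W u" if "0 < u" for u
    using that by (simp add: W_def)
  have C_nonneg: "0 \<le> C_l1"
    unfolding C_l1 set_lebesgue_integral_def by (intro Bochner_Integration.integral_nonneg) (simp add: \<psi>)

  \<comment> \<open>Conclusion, with the degenerate constant treated separately\<close>
  show ?thesis
  proof (cases "C_l1 = 0")
    case True
    have "\<forall>\<^sub>F u in at_top. psi_at K c N X \<psi> u l1 = 0"
      using psi_l1 True by simp
    then have "\<forall>\<^sub>F u in at_top. \<psi> u = 0"
      using eventually_ge_at_top[of 0]
    proof eventually_elim
      case (elim u)
      let ?A = "{y. \<psi> y \<noteq> 0}"
      have "q u l1 = 0" using elim psi_at_eq by simp
      then have "AE w in K l1. ?h u w = 0"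
        unfolding q_def using integral_nonneg_eq_0_iff_AE[OF h_int[OF elim(2), of l1]] \<psi>(2) by simp
      then have null: "AE w in K l1. ruin_time c N X u w < \<infinity> \<longrightarrow> deficit c N X u w \<notin> ?A"
        by (rule eventually_mono) (auto split: if_splits)
      have A: "?A \<in> sets borel"
        using \<psi>(1) by measurable
      have zero: "q u l = 0" if l: "0 \<le> l" "l < l1" for l
      proof -
        have "AE w in K l. ruin_time c N X u w < \<infinity> \<longrightarrow> deficit c N X u w \<notin> ?A"
          using ruin_deficit_null_transfer[OF conditional_model conditional_model _ premium_pos elim(2) A null] l l1(2)
          by auto
        then have "AE w in K l. ?h u w = 0"
          by (rule eventually_mono) auto
        then show ?thesis
          unfolding q_def by (rule integral_eq_zero_AE)
      qed
      have "AE l in G. q u l = 0"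
        using AE_G by (rule eventually_mono) (auto intro: zero)
      then show ?case
        unfolding \<psi>_mix[OF elim(2)] by (rule integral_eq_zero_AE)
    qed
    then show ?thesis using True by simp
  next
    case False
    have "((\<lambda>u. (W u * (LINT l|G. q u l)) / (C_l1 * (W u * (LINT l|G. p u l)))) \<longlongrightarrow> (C_l1 * \<kappa>) / (C_l1 * \<kappa>)) at_top"
      using False \<kappa> by (intro tendsto_divide tendsto_mult tendsto_const cl_asymp \<psi>_asymp) auto
    also have "(C_l1 * \<kappa>) / (C_l1 * \<kappa>) = 1" using False \<kappa> by simp
    finally have "((\<lambda>u. \<psi> u / (C_l1 * psi_cl F K G c N X u)) \<longlongrightarrow> 1) at_top"
    proof (rule Lim_transform_eventually)
      show "\<forall>\<^sub>F u in at_top. W u * (LINT l|G. q u l) / (C_l1 * (W u * (LINT l|G. p u l)))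
          = \<psi> u / (C_l1 * psi_cl F K G c N X u)"
        using eventually_gt_at_top[of 0]
      proof eventually_elim
        case (elim u)
        then show ?case using W_pos[OF elim] \<psi>_mix[of u] psi_cl_eq[of u] by simp
      qed
    qed
    moreover have "((\<lambda>u. C_l1 * psi_cl F K G c N X u / (C_l1 * (B * C1 * Gamma b / (D1 * u) powr b) * exp (- R1 * u))) \<longlongrightarrow> 1) at_top"
    proof (rule Lim_transform_eventually)
      show "((\<lambda>u. (W u * (LINT l|G. p u l)) / \<kappa>) \<longlongrightarrow> 1) at_top"
        using tendsto_divide[OF cl_asymp tendsto_const, of \<kappa>] \<kappa> by simp
      show "\<forall>\<^sub>F u in at_top. W u * (LINT l|G. p u l) / \<kappa>
          = C_l1 * psi_cl F K G c N X u / (C_l1 * (B * C1 * Gamma b / (D1 * u) powr b) * exp (- R1 * u))"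
        using eventually_gt_at_top[of 0]
      proof eventually_elim
        case (elim u)
        \<comment> \<open>The claimed asymptote, up to the factor \<open>C_l1\<close>, is the limit
          \<open>\<kappa>\<close> divided by the normalisation \<open>W u\<close>.\<close>
        have "B * C1 * Gamma b / (D1 * u) powr b * exp (- R1 * u) = \<kappa> / W u"
          using elim constants by (simp add: \<kappa>_def W_def powr_mult exp_minus field_simps)
        then have "C_l1 * (B * C1 * Gamma b / (D1 * u) powr b) * exp (- R1 * u) = C_l1 * (\<kappa> / W u)"
          by (metis mult.assoc)
        then show ?case
          using False \<kappa> W_pos[OF elim] elim psi_cl_eq[of u] by simp
      qed
    qed
    ultimately show ?thesis
      by (intro conjI asymp_equivI')
  qed
qed

end
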